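(* Let $\mathbf{V}=(V_n)_{n\in\mathbb{N}}$ be a good ssee and let $k,N\in\mathbb{N}$. Let $\mathcal{F}$ be a nonempty collection of $k$-colourings of $V_N$ and let $\mathcal{P}=\mathrm{Forb}_{\mathbf{V}}(\mathcal{F})$. For any $\varepsilon>0$ there exists $n_0>0$ such that for any $n\ge n_0$ there is a collection $\mathcal{T}_n$ of $k$-colouring templates for $V_n$ satisfying: (i) for every $c\in\mathcal{P}_n$ there is $t\in\mathcal{T}_n$ with $c\in\langle t\rangle$; (ii) for each $t\in\mathcal{T}_n$ there are at most $\varepsilon\bigl|\binom{V_n}{V_N}\bigr|$ pairs $(\phi,c)$ with $\phi\in\binom{V_n}{V_N}$, $c\in\mathcal{F}$ and $c\in\langle t_{|\phi}\rangle$; (iii) $|\mathcal{T}_n|\le k^{\varepsilon|V_n|}$.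
   Context: A set-sequence equipped with embeddings (ssee) is a sequence $\mathbf{V}=(V_n)_{n\in\mathbb{N}}$ of (finite) sets together with, for every $N\le n$, a collection $\binom{V_n}{V_N}$ of injections $\phi:V_N\to V_n$ (called embeddings). For a set $V$, a $k$-colouring of $V$ is a map $c:V\to[k]$ and a $k$-colouring template of $V$ is a map $t:V\to2^{[k]}\setminus\{\emptyset\}$; $\langle t\rangle$ is the set of $k$-colourings $c$ of $V$ with $c(x)\in t(x)$ for all $x$. For $\phi\in\binom{V_n}{V_N}$, $t_{|\phi}(x)=t(\phi(x))$ and $c_{|\phi}(x)=c(\phi(x))$ for $x\in V_N$. $\mathrm{Forb}_{\mathbf{V}}(\mathcal{F})_n$ is the set of $k$-colourings $c$ of $V_n$ with $c_{|\phi}\notin\mathcal{F}$ for all $\phi\in\binom{V_n}{V_N}$. For $N\le n$ and $i$, let $I_i$ be the number of maps $\phi$ from the disjoint union of two copies of $V_N$ to $V_n$ whose restriction to each copy lies in $\binom{V_n}{V_N}$ and such that the images of the two copies meet in exactly $i$ elements; set $I(N,n)=\sum_{1<i<|V_N|}I_i$. The ssee $\mathbf{V}$ is good if (i) $|V_n|\to\infty$; (ii) for all $N$ with $|V_N|>1$, $\bigl|\binom{V_n}{V_N}\bigr|/|V_n|\to\infty$ as $n\to\infty$; (iii) for all $N$ with $|V_N|>1$, $|V_n|\,I(N,n)/\bigl|\binom{V_n}{V_N}\bigr|^2\to0$ as $n\to\infty$. *)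

theory Defs
  imports Complex_Main "HOL-Library.FuncSet"
begin

text \<open>
  Maps with domain \<open>V n\<close> (embeddings, colourings, templates) are represented by extensional
  functions, so that \<open>card\<close> and set membership do not depend on values off the domain.
  The set \<open>emb n N\<close> stands for the embeddings of \<open>V N\<close> into \<open>V n\<close>; it carries
  no meaning unless \<open>N \<le> n\<close>.
\<close>

locale ssee =
  fixes V :: "nat \<Rightarrow> 'a set"
    and emb :: "nat \<Rightarrow> nat \<Rightarrow> ('a \<Rightarrow> 'a) set"
  assumes finite_V: "finite (V n)"
    and emb_maps: "N \<le> n \<Longrightarrow> \<phi> \<in> emb n N \<Longrightarrow> \<phi> \<in> V N \<rightarrow>\<^sub>E V n"
    and emb_inj: "N \<le> n \<Longrightarrow> \<phi> \<in> emb n N \<Longrightarrow> inj_on \<phi> (V N)"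

definition colourings :: "nat \<Rightarrow> 'a set \<Rightarrow> ('a \<Rightarrow> nat) set" where
  "colourings k X = X \<rightarrow>\<^sub>E {1..k}"

definition templates :: "nat \<Rightarrow> 'a set \<Rightarrow> ('a \<Rightarrow> nat set) set" where
  "templates k X = X \<rightarrow>\<^sub>E (Pow {1..k} - {{}})"

definition realisations :: "nat \<Rightarrow> 'a set \<Rightarrow> ('a \<Rightarrow> nat set) \<Rightarrow> ('a \<Rightarrow> nat) set" where
  "realisations k X t = {c \<in> colourings k X. \<forall>x\<in>X. c x \<in> t x}"

definition pullback :: "'a set \<Rightarrow> ('a \<Rightarrow> 'b) \<Rightarrow> ('b \<Rightarrow> 'c) \<Rightarrow> 'a \<Rightarrow> 'c" where
  "pullback X \<phi> f = (\<lambda>x\<in>X. f (\<phi> x))"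

definition Forb ::
  "(nat \<Rightarrow> 'a set) \<Rightarrow> (nat \<Rightarrow> nat \<Rightarrow> ('a \<Rightarrow> 'a) set) \<Rightarrow> nat \<Rightarrow> nat \<Rightarrow> ('a \<Rightarrow> nat) set
     \<Rightarrow> nat \<Rightarrow> ('a \<Rightarrow> nat) set" where
  "Forb V emb k N F n = {c \<in> colourings k (V n). \<forall>\<phi>\<in>emb n N. pullback (V N) \<phi> c \<notin> F}"

definition overlap_count ::
  "(nat \<Rightarrow> 'a set) \<Rightarrow> (nat \<Rightarrow> nat \<Rightarrow> ('a \<Rightarrow> 'a) set) \<Rightarrow> nat \<Rightarrow> nat \<Rightarrow> nat \<Rightarrow> nat" where
  "overlap_count V emb N n i =
     card {\<phi> \<in> (V N <+> V N) \<rightarrow>\<^sub>E V n.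
             pullback (V N) Inl \<phi> \<in> emb n N \<and>
             pullback (V N) Inr \<phi> \<in> emb n N \<and>
             card (\<phi> ` Inl ` V N \<inter> \<phi> ` Inr ` V N) = i}"

definition overlap_total ::
  "(nat \<Rightarrow> 'a set) \<Rightarrow> (nat \<Rightarrow> nat \<Rightarrow> ('a \<Rightarrow> 'a) set) \<Rightarrow> nat \<Rightarrow> nat \<Rightarrow> nat" where
  "overlap_total V emb N n = (\<Sum>i\<in>{1<..<card (V N)}. overlap_count V emb N n i)"

locale good_ssee = ssee V emb
  for V :: "nat \<Rightarrow> 'a set" and emb :: "nat \<Rightarrow> nat \<Rightarrow> ('a \<Rightarrow> 'a) set" +
  assumes card_V_at_top: "filterlim (\<lambda>n. card (V n)) at_top sequentially"
    and emb_density: "card (V N) > 1 \<Longrightarrow>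
      filterlim (\<lambda>n. real (card (emb n N)) / real (card (V n))) at_top sequentially"
    and overlap_small: "card (V N) > 1 \<Longrightarrow>
      (\<lambda>n. real (card (V n)) * real (overlap_total V emb N n) / (real (card (emb n N)))\<^sup>2)
        \<longlonglongrightarrow> 0"

end

theory Submission imports Defs begin

text \<open>
  Consider the hypergraph on \<open>V n \<times> {1..k}\<close> whose edges are the coloured images
  \<open>{(\<phi> x, f x) | x \<in> V N}\<close> with \<open>\<phi>\<close> an embedding and \<open>f \<in> F\<close>. The graph of a colouring in
  \<open>Forb\<close> is an independent set, and a subset of \<open>V n \<times> {1..k}\<close> is a template, so the theorem asks for few
  sparse containers. Condition (iii) shows that all but \<open>o(|emb|)\<close> embeddings contain only pairs of
  codegree \<open>o(|emb| / |V n|)\<close>, so after deleting the others all codegrees are small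
  compared with the average degree.

  For hypergraphs with bounded maximum degree and small codegrees, containers are built by
  induction on the uniformity. Vertices of large degree are queried one after the other; those in
  the independent set \<open>I\<close> form a small fingerprint \<open>S\<close>. Either the hypergraph becomes sparse before \<open>S\<close>
  has \<open>\<tau> n\<close> elements, or the link of \<open>S\<close> is a hypergraph of smaller uniformity in which \<open>I\<close> is
  independent and whose containers miss a constant proportion of the vertices. Repeating this
  boundedly often gives sparse containers.
\<close>

section \<open>Families of containers\<close>

text \<open>The family \<open>\<I>\<close> is arbitrary rather than the family of all independent
  sets, so that it can be split into branches and restricted to a container found earlier.\<close>

definition has_containers ::
  "'v set \<Rightarrow> 'v set set \<Rightarrow> ('v set \<Rightarrow> bool) \<Rightarrow> real \<Rightarrow> bool" where
  "has_containers W \<I> P M \<longleftrightarrow>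
     (\<exists>\<C>\<subseteq>Pow W. real (card \<C>) \<le> M \<and> (\<forall>C\<in>\<C>. P C) \<and> (\<forall>I\<in>\<I>. \<exists>C\<in>\<C>. I \<subseteq> C))"

text \<open>
  A hypergraph is a vertex set \<open>W\<close> with a family \<open>g\<close> of edges indexed by \<open>E\<close>. Indexing
  allows repeated edges, which arise when vertices are removed from the edges of a hypergraph.
\<close>

definition indep_sets :: "'v set \<Rightarrow> 'e set \<Rightarrow> ('e \<Rightarrow> 'v set) \<Rightarrow> 'v set set" where
  "indep_sets W E g = {I. I \<subseteq> W \<and> (\<forall>e\<in>E. \<not> g e \<subseteq> I)}"

definition degree :: "'e set \<Rightarrow> ('e \<Rightarrow> 'v set) \<Rightarrow> 'v \<Rightarrow> nat" where
  "degree E g v = card {e \<in> E. v \<in> g e}"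

definition codegree :: "'e set \<Rightarrow> ('e \<Rightarrow> 'v set) \<Rightarrow> 'v \<Rightarrow> 'v \<Rightarrow> nat" where
  "codegree E g u v = card {e \<in> E. u \<in> g e \<and> v \<in> g e}"

definition induced :: "'e set \<Rightarrow> ('e \<Rightarrow> 'v set) \<Rightarrow> 'v set \<Rightarrow> 'e set" where
  "induced E g A = {e \<in> E. g e \<subseteq> A}"

lemma has_containers_mono:
  assumes "has_containers W \<I> P M" "\<I>' \<subseteq> \<I>" "\<And>C. C \<subseteq> W \<Longrightarrow> P C \<Longrightarrow> P' C" "M \<le> M'"
  shows "has_containers W \<I>' P' M'"
proof -
  obtain \<C> where c: "\<C>\<subseteq>Pow W" "real (card \<C>) \<le> M" "\<forall>C\<in>\<C>. P C" "\<forall>I\<in>\<I>. \<exists>C\<in>\<C>. I \<subseteq> C"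
    using assms(1) unfolding has_containers_def by blast
  show ?thesis unfolding has_containers_def
    by (rule exI[of _ \<C>]) (use c assms(2-) in \<open>auto simp: subset_iff\<close>)
qed

lemma has_containers_single:
  assumes "\<And>I. I \<in> \<I> \<Longrightarrow> I \<subseteq> C" "C \<subseteq> W" "P C" "1 \<le> M"
  shows "has_containers W \<I> P M"
  unfolding has_containers_def by (rule exI[of _ "{C}"]) (use assms in auto)

lemma has_containers_empty:
  assumes "\<I> = {}" "0 \<le> M"
  shows "has_containers W \<I> P M"
  unfolding has_containers_def by (rule exI[of _ "{}"]) (use assms in auto)

lemma has_containers_superset:
  assumes "has_containers A \<I> P M" "A \<subseteq> W"
  shows "has_containers W \<I> P M"
proof -
  obtain \<C> where c: "\<C>\<subseteq>Pow A" "real (card \<C>) \<le> M" "\<forall>C\<in>\<C>. P C" "\<forall>I\<in>\<I>. \<exists>C\<in>\<C>. I \<subseteq> C"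
    using assms(1) unfolding has_containers_def by blast
  moreover have "\<C> \<subseteq> Pow W" using c(1) assms(2) by blast
  ultimately show ?thesis unfolding has_containers_def by blast
qed

lemma has_containers_UN:
  assumes "finite J" "\<And>j. j \<in> J \<Longrightarrow> has_containers W (\<I> j) P M"
  shows "has_containers W (\<Union>j\<in>J. \<I> j) P (real (card J) * M)"
proof -
  have "\<forall>j\<in>J. \<exists>\<C>\<subseteq>Pow W. real (card \<C>) \<le> M \<and> (\<forall>C\<in>\<C>. P C) \<and> (\<forall>I\<in>\<I> j. \<exists>C\<in>\<C>. I \<subseteq> C)"
    using assms(2) unfolding has_containers_def by blast
  then obtain \<C> where c: "\<And>j. j \<in> J \<Longrightarrow> \<C> j \<subseteq> Pow W \<and> real (card (\<C> j)) \<le> M \<and>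
      (\<forall>C\<in>\<C> j. P C) \<and> (\<forall>I\<in>\<I> j. \<exists>C\<in>\<C> j. I \<subseteq> C)"
    by (metis (no_types) bchoice)
  have "real (card (\<Union>j\<in>J. \<C> j)) \<le> (\<Sum>j\<in>J. real (card (\<C> j)))"
    using card_UN_le[OF assms(1), of \<C>] by (simp flip: of_nat_sum)
  also have "\<dots> \<le> real (card J) * M"
    using c by (intro sum_bounded_above) auto
  finally have card: "real (card (\<Union>j\<in>J. \<C> j)) \<le> real (card J) * M" .
  have sub: "(\<Union>j\<in>J. \<C> j) \<subseteq> Pow W" and P: "\<forall>C\<in>(\<Union>j\<in>J. \<C> j). P C"
    using c by blast+
  have cover: "\<forall>I\<in>(\<Union>j\<in>J. \<I> j). \<exists>C\<in>(\<Union>j\<in>J. \<C> j). I \<subseteq> C"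
  proof
    fix I assume "I \<in> (\<Union>j\<in>J. \<I> j)"
    then obtain j where j: "j \<in> J" "I \<in> \<I> j" by blast
    then obtain C where "C \<in> \<C> j" "I \<subseteq> C" using c by blast
    then show "\<exists>C\<in>(\<Union>j\<in>J. \<C> j). I \<subseteq> C" using j by blast
  qed
  show ?thesis unfolding has_containers_def using card sub P cover by blast
qed

lemma has_containers_Un:
  assumes "has_containers W \<I>1 P M1" "has_containers W \<I>2 P M2"
  shows "has_containers W (\<I>1 \<union> \<I>2) P (M1 + M2)"
proof -
  obtain \<C>1 where c1: "\<C>1\<subseteq>Pow W" "real (card \<C>1) \<le> M1" "\<forall>C\<in>\<C>1. P C" "\<forall>I\<in>\<I>1. \<exists>C\<in>\<C>1. I \<subseteq> C"
    using assms(1) unfolding has_containers_def by blast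
  obtain \<C>2 where c2: "\<C>2\<subseteq>Pow W" "real (card \<C>2) \<le> M2" "\<forall>C\<in>\<C>2. P C" "\<forall>I\<in>\<I>2. \<exists>C\<in>\<C>2. I \<subseteq> C"
    using assms(2) unfolding has_containers_def by blast
  have "real (card (\<C>1 \<union> \<C>2)) \<le> M1 + M2"
    using card_Un_le[of \<C>1 \<C>2] c1(2) c2(2) by linarith
  moreover have "\<C>1 \<union> \<C>2 \<subseteq> Pow W" "\<forall>C\<in>\<C>1 \<union> \<C>2. P C"
    using c1(1,3) c2(1,3) by blast+
  moreover have "\<forall>I\<in>\<I>1 \<union> \<I>2. \<exists>C\<in>\<C>1 \<union> \<C>2. I \<subseteq> C"
    unfolding ball_Un bex_Un using c1(4) c2(4) by simp
  ultimately show ?thesis unfolding has_containers_def by blast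
qed

text \<open>Post-processing: \<open>f\<close> may alter a container as long as it keeps every member
  of \<open>\<I>\<close> lying in it.\<close>

lemma has_containers_image:
  assumes "has_containers W \<I> P M" "finite W"
    and "\<And>C. C \<subseteq> W \<Longrightarrow> P C \<Longrightarrow> f C \<subseteq> W \<and> P' (f C)"
    and "\<And>C I. I \<in> \<I> \<Longrightarrow> C \<subseteq> W \<Longrightarrow> I \<subseteq> C \<Longrightarrow> I \<subseteq> f C"
  shows "has_containers W \<I> P' M"
proof -
  obtain \<C> where c: "\<C>\<subseteq>Pow W" "real (card \<C>) \<le> M" "\<forall>C\<in>\<C>. P C" "\<forall>I\<in>\<I>. \<exists>C\<in>\<C>. I \<subseteq> C"
    using assms(1) unfolding has_containers_def by blast
  have "finite \<C>" using c(1) assms(2) by (meson finite_Pow_iff finite_subset)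
  then have "real (card (f ` \<C>)) \<le> M"
    using card_image_le[of \<C> f] c(2) by linarith
  moreover have "f C \<subseteq> W \<and> P' (f C)" if "C \<in> \<C>" for C
    using assms(3)[of C] c that by blast
  then have "f ` \<C> \<subseteq> Pow W" "\<forall>C\<in>f ` \<C>. P' C"
    by simp_all blast
  moreover have "\<forall>I\<in>\<I>. \<exists>C\<in>f ` \<C>. I \<subseteq> C"
  proof
    fix I assume I: "I \<in> \<I>"
    then obtain C where C: "C \<in> \<C>" "I \<subseteq> C" using c by blast
    then have "I \<subseteq> f C" using assms(4)[OF I] c(1) by blast
    then show "\<exists>C\<in>f ` \<C>. I \<subseteq> C" using C by blast
  qed
  ultimately show ?thesis unfolding has_containers_def by blast
qed

text \<open>The second round is run inside each container of the first, so the cardinalities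
  multiply.\<close>

lemma has_containers_refine:
  assumes "has_containers W \<I> Q M1" "finite W" "0 \<le> M2"
    and "\<And>C. C \<subseteq> W \<Longrightarrow> Q C \<Longrightarrow> has_containers W {I\<in>\<I>. I \<subseteq> C} P M2"
  shows "has_containers W \<I> P (M1 * M2)"
proof -
  obtain \<C> where c: "\<C>\<subseteq>Pow W" "real (card \<C>) \<le> M1" "\<forall>C\<in>\<C>. Q C" "\<forall>I\<in>\<I>. \<exists>C\<in>\<C>. I \<subseteq> C"
    using assms(1) unfolding has_containers_def by blast
  have "finite \<C>" using c(1) assms(2) by (meson finite_Pow_iff finite_subset)
  then have "has_containers W (\<Union>C\<in>\<C>. {I\<in>\<I>. I \<subseteq> C}) P (real (card \<C>) * M2)"
    using c assms(4) by (intro has_containers_UN) auto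
  then show ?thesis
    by (rule has_containers_mono) (use c assms(3) in \<open>auto intro: mult_right_mono\<close>)
qed

lemma has_containers_inter:
  assumes "has_containers W \<I> P M1" "has_containers W \<I> Q M2" "finite W" "0 \<le> M2"
    and "\<And>C D. D \<subseteq> C \<Longrightarrow> P C \<Longrightarrow> P D" "\<And>C D. D \<subseteq> C \<Longrightarrow> Q C \<Longrightarrow> Q D"
  shows "has_containers W \<I> (\<lambda>C. P C \<and> Q C) (M1 * M2)"
  using assms(1,3,4)
proof (rule has_containers_refine)
  fix C assume C: "C \<subseteq> W" "P C"
  have "has_containers W {I\<in>\<I>. I \<subseteq> C} Q M2"
    using assms(2) by (rule has_containers_mono) auto
  then show "has_containers W {I\<in>\<I>. I \<subseteq> C} (\<lambda>C. P C \<and> Q C) M2"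
  proof (rule has_containers_image[where f = "\<lambda>D. D \<inter> C"])
    fix D assume "D \<subseteq> W" "Q D"
    then show "D \<inter> C \<subseteq> W \<and> P (D \<inter> C) \<and> Q (D \<inter> C)"
      using assms(5)[of "D \<inter> C" C] assms(6)[of "D \<inter> C" D] C by blast
  qed (use assms(3) in auto)
qed

lemma has_containers_INT:
  assumes "\<And>j. j < i \<Longrightarrow> has_containers W \<I> (P j) M" "finite W" "0 \<le> M" "\<I> \<subseteq> Pow W"
    and "\<And>j C D. D \<subseteq> C \<Longrightarrow> P j C \<Longrightarrow> P j D"
  shows "has_containers W \<I> (\<lambda>C. \<forall>j<i. P j C) (M ^ i)"
  using assms(1)
proof (induction i)
  case 0
  show ?case by (rule has_containers_single[where C = W]) (use assms(4) in auto)
next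
  case (Suc i)
  have "has_containers W \<I> (\<lambda>C. (\<forall>j<i. P j C) \<and> P i C) (M ^ i * M)"
  proof (rule has_containers_inter[OF Suc.IH Suc.prems assms(2,3)])
    show "\<forall>j<i. P j D" if "D \<subseteq> C" "\<forall>j<i. P j C" for C D using assms(5) that by blast
    show "P i D" if "D \<subseteq> C" "P i C" for C D using assms(5) that by blast
  qed (use Suc.prems in auto)
  then show ?case by (rule has_containers_mono) (auto simp: less_Suc_eq mult.commute)
qed

section \<open>Double counting of vertex degrees\<close>

lemma card_le_degree_sum:
  assumes "finite A" "\<And>e. e \<in> E \<Longrightarrow> g e \<inter> A \<noteq> {}" "finite E"
  shows "card E \<le> (\<Sum>v\<in>A. degree E g v)"
proof -
  have "E \<subseteq> (\<Union>v\<in>A. {e\<in>E. v \<in> g e})" using assms(2) by blast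
  then have "card E \<le> card (\<Union>v\<in>A. {e\<in>E. v \<in> g e})"
    using assms by (intro card_mono) auto
  also have "\<dots> \<le> (\<Sum>v\<in>A. degree E g v)"
    unfolding degree_def using assms(1) by (rule card_UN_le)
  finally show ?thesis .
qed

text \<open>Used in two directions: few vertices of bounded degree destroy few edges when deleted,
  and a set meeting many edges must be large.\<close>

lemma card_meeting_le:
  assumes "finite A" "\<And>e. e \<in> E' \<Longrightarrow> g e \<inter> A \<noteq> {}" "finite E" "E' \<subseteq> E"
    and "\<And>v. v \<in> A \<Longrightarrow> real (degree E g v) \<le> D"
  shows "real (card E') \<le> real (card A) * D"
proof -
  have fin: "finite E'" using assms finite_subset by blast
  have "real (card E') \<le> (\<Sum>v\<in>A. real (degree E' g v))"
    unfolding of_nat_sum[symmetric] of_nat_le_iff using assms(1,2) fin by (rule card_le_degree_sum)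
  also have "\<dots> \<le> (\<Sum>v\<in>A. D)"
  proof (rule sum_mono)
    fix v assume "v \<in> A"
    have "degree E' g v \<le> degree E g v"
      unfolding degree_def using assms(3,4) by (intro card_mono) auto
    then show "real (degree E' g v) \<le> D" using assms(5)[OF \<open>v \<in> A\<close>] by linarith
  qed
  finally show ?thesis by simp
qed

lemma sum_degree_le:
  assumes "finite A" "finite E" "\<And>e. e \<in> E \<Longrightarrow> card (g e) \<le> r \<and> finite (g e)"
  shows "(\<Sum>v\<in>A. degree E g v) \<le> r * card E"
proof -
  have "(\<Sum>v\<in>A. degree E g v) = (\<Sum>v\<in>A. \<Sum>e\<in>E. if v \<in> g e then 1 else 0)"
    unfolding degree_def by (simp only: card_eq_sum sum.inter_filter[OF assms(2)])
  also have "\<dots> = (\<Sum>e\<in>E. \<Sum>v\<in>A. if v \<in> g e then 1 else 0)"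
    by (rule sum.swap)
  also have "\<dots> = (\<Sum>e\<in>E. card (A \<inter> g e))"
    using assms(1) by (simp add: card_eq_sum sum.inter_restrict flip: One_nat_def del: sum_constant)
  also have "\<dots> \<le> (\<Sum>e\<in>E. r)"
  proof (rule sum_mono)
    fix e assume e: "e \<in> E"
    have "card (A \<inter> g e) \<le> card (g e)" using assms(3)[OF e] by (intro card_mono) auto
    then show "card (A \<inter> g e) \<le> r" using assms(3)[OF e] by linarith
  qed
  finally show ?thesis by (simp add: mult.commute)
qed

text \<open>Markov's inequality for degrees, whose sum is at most \<open>r * card E\<close>.\<close>

lemma card_high_degree_le:
  assumes "finite A" "finite E" "\<And>e. e \<in> E \<Longrightarrow> card (g e) \<le> r \<and> finite (g e)"
    and "\<And>v. v \<in> A \<Longrightarrow> \<theta> \<le> real (degree E g v)"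
  shows "real (card A) * \<theta> \<le> real r * real (card E)"
proof -
  have "real (card A) * \<theta> \<le> (\<Sum>v\<in>A. real (degree E g v))"
    using assms(4) by (intro sum_bounded_below) auto
  also have "\<dots> \<le> real (r * card E)"
    unfolding of_nat_sum[symmetric] of_nat_le_iff using assms(1-3) by (rule sum_degree_le)
  finally show ?thesis by simp
qed

section \<open>The container algorithm\<close>

definition link :: "('e \<Rightarrow> 'v set) \<Rightarrow> ('e \<Rightarrow> 'v) \<Rightarrow> 'e \<Rightarrow> 'v set" where
  "link g h e = g e - {h e}"

text \<open>
  The state of the container algorithm: \<open>S\<close> is the part of the independent set found so far, and
  \<open>Q\<close> the edges collected, each through the vertex \<open>h e\<close> of \<open>S\<close>. An edge is no longer collected once
  one of its vertices has degree at least \<open>\<theta>\<close> in the link hypergraph, so that link degrees exceed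
  \<open>\<theta>\<close> by at most one codegree.
\<close>

definition link_state ::
  "'e set \<Rightarrow> ('e \<Rightarrow> 'v set) \<Rightarrow> real \<Rightarrow> real \<Rightarrow> 'v set \<Rightarrow> 'e set \<Rightarrow> ('e \<Rightarrow> 'v) \<Rightarrow> bool" where
  "link_state E g D d S Q h \<longleftrightarrow> Q \<subseteq> E \<and> (\<forall>e\<in>Q. h e \<in> g e \<and> h e \<in> S) \<and>
     (\<forall>u. real (degree Q (link g h) u) \<le> D) \<and> real (card S) * d \<le> real (card Q)"

definition unsaturated ::
  "'e set \<Rightarrow> ('e \<Rightarrow> 'v set) \<Rightarrow> real \<Rightarrow> 'e set \<Rightarrow> ('e \<Rightarrow> 'v) \<Rightarrow> 'v set \<Rightarrow> 'e set" where
  "unsaturated E g \<theta> Q h A =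
     {e \<in> E. g e \<subseteq> A \<and> (\<forall>u\<in>g e. real (degree Q (link g h) u) < \<theta>)}"

text \<open>The queried vertex \<open>v\<close> turns out to be in the independent set. A vertex
  \<open>u\<close> of link degree below \<open>\<theta>\<close> gains at most the codegree of
  \<open>u\<close> and \<open>v\<close>; a saturated one gains nothing. The new edges, at least
  \<open>d\<close> many, pay for the new vertex of \<open>S\<close>.\<close>

lemma link_state_extend:
  assumes st: "link_state E g (\<theta> + c) d S Q h" and fin: "finite E" "finite S"
    and disj: "S \<inter> A = {}" and v: "v \<in> A"
    and X_def: "X = {e \<in> unsaturated E g \<theta> Q h A. v \<in> g e}" and big: "d \<le> real (card X)"
    and codeg: "\<And>u. u \<noteq> v \<Longrightarrow> real (codegree E g u v) \<le> c"
  shows "link_state E g (\<theta> + c) d (insert v S) (Q \<union> X) (\<lambda>e. if e \<in> X then v else h e)"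
    (is "link_state _ _ _ _ _ _ ?h")
proof -
  have QE: "Q \<subseteq> E" and hQ: "\<And>e. e \<in> Q \<Longrightarrow> h e \<in> g e \<and> h e \<in> S"
    and degQ: "\<And>u. real (degree Q (link g h) u) \<le> \<theta> + c" and cQ: "real (card S) * d \<le> real (card Q)"
    using st unfolding link_state_def by auto
  have XE: "X \<subseteq> E" and XA: "\<And>e. e \<in> X \<Longrightarrow> g e \<subseteq> A" and Xv: "\<And>e. e \<in> X \<Longrightarrow> v \<in> g e"
    unfolding X_def unsaturated_def by auto
  have finQ: "finite Q" "finite X" using QE XE fin(1) by (simp_all add: finite_subset)
  \<comment> \<open>Edges of \<open>Q\<close> have a vertex in \<open>S\<close>, edges of
    \<open>X\<close> lie in \<open>A\<close>. Hence \<open>h\<close> can be redefined on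
    \<open>X\<close> without changing the links of \<open>Q\<close>.\<close>
  have QX: "Q \<inter> X = {}" using hQ XA disj by blast
  have deg: "real (degree (Q \<union> X) (link g ?h) u) \<le> \<theta> + c" for u
  proof -
    have split: "{e \<in> Q \<union> X. u \<in> link g ?h e} = {e \<in> Q. u \<in> link g h e} \<union> {e \<in> X. u \<in> g e \<and> u \<noteq> v}"
      using QX unfolding link_def by auto
    show ?thesis
    proof (cases "u \<noteq> v \<and> real (degree Q (link g h) u) < \<theta>")
      case True
      have "card {e \<in> X. u \<in> g e \<and> u \<noteq> v} \<le> codegree E g u v"
        unfolding codegree_def using XE Xv fin by (intro card_mono) auto
      then have "real (card {e \<in> X. u \<in> g e \<and> u \<noteq> v}) \<le> c"
        using codeg[of u] True by linarith
      moreover have "degree (Q \<union> X) (link g ?h) u \<le> degree Q (link g h) u + card {e \<in> X. u \<in> g e \<and> u \<noteq> v}"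
        unfolding degree_def split by (rule card_Un_le)
      ultimately show ?thesis using True by linarith
    next
      case False
      then have "{e \<in> X. u \<in> g e \<and> u \<noteq> v} = {}"
        unfolding X_def unsaturated_def by auto
      then show ?thesis using degQ[of u] unfolding degree_def split by (simp only: Un_empty_right)
    qed
  qed
  have "real (card (insert v S)) * d = real (card S) * d + d"
    using disj v fin by (subst card_insert_disjoint) (auto simp: algebra_simps)
  also have "\<dots> \<le> real (card (Q \<union> X))"
    using cQ big QX finQ by (simp add: card_Un_disjoint)
  finally show ?thesis
    unfolding link_state_def using deg QE XE hQ Xv by auto
qed

text \<open>
  At each step a vertex \<open>v\<close> of large degree is queried: either \<open>v\<close> leaves the container, or it joins
  \<open>S\<close>. The number of leaves of this decision tree is governed by the weight \<open>(1 + 1/y)\<^sup>a y\<^sup>b\<close>, with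
  \<open>a\<close> vertices left to query and \<open>b\<close> more that may join \<open>S\<close>, which satisfies the branching
  recursion with equality.
\<close>

lemma container_tree:
  fixes E :: "'e set" and g :: "'e \<Rightarrow> 'v set"
  assumes fin: "finite W" "finite E"
    and nonempty: "\<And>e. e \<in> E \<Longrightarrow> g e \<noteq> {}"
    and codeg: "\<And>u v. u \<noteq> v \<Longrightarrow> real (codegree E g u v) \<le> c"
    and big: "real (card W) * d \<le> U" and d: "0 \<le> d"
    and y: "1 \<le> (y::real)" and M: "1 \<le> (M::real)"
    and leaf_full: "\<And>S Q h. S \<subseteq> W \<Longrightarrow> card S = s \<Longrightarrow> link_state E g (\<theta> + c) d S Q h \<Longrightarrow>
      has_containers W {I\<in>\<I>. S \<subseteq> I} P M"
    and leaf_few: "\<And>A S Q h. A \<subseteq> W \<Longrightarrow> S \<subseteq> W \<Longrightarrow> card S \<le> s \<Longrightarrow> link_state E g (\<theta> + c) d S Q h \<Longrightarrow>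
      real (card (unsaturated E g \<theta> Q h A)) \<le> U \<Longrightarrow> P (A \<union> S)"
    and state: "A \<subseteq> W" "S \<subseteq> W" "A \<inter> S = {}" "card S \<le> s" "link_state E g (\<theta> + c) d S Q h"
  shows "has_containers W {I\<in>\<I>. S \<subseteq> I \<and> I \<subseteq> A \<union> S} P (M * (1 + 1/y) ^ card A * y ^ (s - card S))"
  using state
proof (induction "card A" arbitrary: A S Q h rule: less_induct)
  case less
  have finA: "finite A" "finite S"
    using less.prems(1,2) fin(1) by (simp_all add: finite_subset)
  have one: "1 \<le> (1 + 1/y) ^ card A" "1 \<le> y ^ (s - card S)"
    using y by (auto intro!: one_le_power)
  then have one': "1 \<le> (1 + 1/y) ^ card A * y ^ (s - card S)"
    by (metis mult_mono' mult_1 zero_le_one)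
  then have MM: "M \<le> M * (1 + 1/y) ^ card A * y ^ (s - card S)"
    using M mult_left_mono[OF one', of M] by (simp add: mult.assoc)
  have MM1: "1 \<le> M * (1 + 1/y) ^ card A * y ^ (s - card S)" using MM M by linarith
  consider "card S = s" | "real (card (unsaturated E g \<theta> Q h A)) \<le> U"
    | "card S < s" "real (card (unsaturated E g \<theta> Q h A)) > U"
    using less.prems(4) by linarith
  then show ?case
  proof cases
    case 1
    show ?thesis
      by (rule has_containers_mono[OF leaf_full[OF less.prems(2) 1 less.prems(5)]]) (use MM in auto)
  next
    case 2
    show ?thesis
      by (rule has_containers_single[where C = "A \<union> S"])
         (use leaf_few[OF less.prems(1,2,4,5) 2] less.prems(1,2) MM1 in simp_all)
  next
    case 3
    let ?U = "unsaturated E g \<theta> Q h A"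
    have finU: "finite ?U" using fin unfolding unsaturated_def by auto
    \<comment> \<open>Averaging: every unsaturated edge meets \<open>A\<close>, so if all degrees
      were below \<open>d\<close> there would be at most \<open>card W * d \<le> U\<close> such
      edges.\<close>
    have "\<exists>v\<in>A. d \<le> real (degree ?U g v)"
    proof (rule ccontr)
      assume "\<not> ?thesis"
      then have "real (degree ?U g v) \<le> d" if "v \<in> A" for v
        using that by (meson linear)
      moreover have "g e \<inter> A \<noteq> {}" if "e \<in> ?U" for e
        using that nonempty[of e] unfolding unsaturated_def by blast
      ultimately have "real (card ?U) \<le> real (card A) * d"
        using finA(1) finU by (intro card_meeting_le[where E = ?U and g = g]) simp_all
      also have "\<dots> \<le> real (card W) * d"
        using card_mono[OF fin(1) less.prems(1)] d by (intro mult_right_mono) simp_all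
      finally show False using 3 big by linarith
    qed
    then obtain v where v: "v \<in> A" "d \<le> real (degree ?U g v)" by blast
    define X where "X = {e \<in> ?U. v \<in> g e}"
    have st: "link_state E g (\<theta> + c) d (insert v S) (Q \<union> X) (\<lambda>e. if e \<in> X then v else h e)"
    proof (rule link_state_extend[OF less.prems(5) fin(2) finA(2) _ v(1) X_def])
      show "S \<inter> A = {}" using less.prems(3) by blast
      show "d \<le> real (card X)" using v(2) unfolding X_def degree_def .
      show "real (codegree E g u v) \<le> c" if "u \<noteq> v" for u using codeg that .
    qed
    have vS: "v \<notin> S" using v less.prems by auto
    have cA: "card A = Suc (card (A - {v}))" using finA v by (metis card.remove)
    have cS: "s - card S = Suc (s - card (insert v S))" using vS finA 3 by simp
    let ?a = "card (A - {v})" and ?b = "s - card (insert v S)"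
    have h1: "has_containers W {I\<in>\<I>. S \<subseteq> I \<and> I \<subseteq> (A - {v}) \<union> S} P
        (M * (1 + 1/y) ^ ?a * y ^ (s - card S))"
    proof (rule less.hyps)
      show "card (A - {v}) < card A" using cA by linarith
      show "A - {v} \<subseteq> W" "(A - {v}) \<inter> S = {}" using less.prems(1,3) by blast+
    qed fact+
    have h2: "has_containers W {I\<in>\<I>. insert v S \<subseteq> I \<and> I \<subseteq> (A - {v}) \<union> insert v S} P
        (M * (1 + 1/y) ^ ?a * y ^ ?b)"
    proof (rule less.hyps[OF _ _ _ _ _ st])
      show "card (A - {v}) < card A" using cA by linarith
      show "A - {v} \<subseteq> W" "insert v S \<subseteq> W" "(A - {v}) \<inter> insert v S = {}"
        using less.prems(1-3) v(1) by blast+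
      show "card (insert v S) \<le> s" using vS finA(2) 3(1) by simp
    qed
    show ?thesis
    proof (rule has_containers_mono[OF has_containers_Un[OF h1 h2]])
      show "M * (1 + 1/y) ^ ?a * y ^ (s - card S) + M * (1 + 1/y) ^ ?a * y ^ ?b
          \<le> M * (1 + 1/y) ^ card A * y ^ (s - card S)"
        unfolding cA cS using y by (simp add: field_simps)
    qed (use v(1) in blast)+
  qed
qed

section \<open>Hypergraphs of bounded degree, by induction on the uniformity\<close>

text \<open>\<open>n\<close> only bounds \<open>card W\<close>, so induced subhypergraphs obey the
  same bounds with the same \<open>n\<close>.\<close>

definition bounded_hypergraph ::
  "nat \<Rightarrow> nat \<Rightarrow> real \<Rightarrow> real \<Rightarrow> 'v set \<Rightarrow> 'e set \<Rightarrow> ('e \<Rightarrow> 'v set) \<Rightarrow> bool" where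
  "bounded_hypergraph n r D c W E g \<longleftrightarrow> finite W \<and> card W \<le> n \<and> finite E \<and>
     (\<forall>e\<in>E. g e \<subseteq> W \<and> card (g e) = r) \<and> (\<forall>v. real (degree E g v) \<le> D) \<and>
     (\<forall>u v. u \<noteq> v \<longrightarrow> real (codegree E g u v) \<le> c)"

text \<open>\<open>K\<close> is the scale of the degrees and \<open>K * real n\<close> that of the
  number of edges. It is a separate parameter because the link hypergraph lives at the scale
  \<open>\<tau> * K\<close>.\<close>

definition admits_containers ::
  "real \<Rightarrow> real \<Rightarrow> nat \<Rightarrow> 'v set \<Rightarrow> 'e set \<Rightarrow> ('e \<Rightarrow> 'v set) \<Rightarrow> bool" where
  "admits_containers \<epsilon> K n W E g \<longleftrightarrow> has_containers W (indep_sets W E g)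
     (\<lambda>C. real (card (induced E g C)) \<le> \<epsilon> * K * real n) (2 powr (\<epsilon> * real n))"

lemma bounded_hypergraph_induced:
  assumes "bounded_hypergraph n r D c W E g" "A \<subseteq> W"
  shows "bounded_hypergraph n r D c A (induced E g A) g"
proof -
  have fin: "finite W" "finite E" "card W \<le> n" using assms unfolding bounded_hypergraph_def by auto
  have "degree (induced E g A) g v \<le> degree E g v" for v
    unfolding degree_def induced_def using fin by (intro card_mono) auto
  then have d: "real (degree (induced E g A) g v) \<le> D" for v
    using assms(1) unfolding bounded_hypergraph_def by (meson of_nat_le_iff order_trans)
  have "codegree (induced E g A) g u v \<le> codegree E g u v" for u v
    unfolding codegree_def induced_def using fin by (intro card_mono) auto
  then have c: "real (codegree (induced E g A) g u v) \<le> c" if "u \<noteq> v" for u v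
    using assms(1) that unfolding bounded_hypergraph_def by (meson of_nat_le_iff order_trans)
  have "finite A" "card A \<le> n"
    using fin assms(2) card_mono[of W A] by (auto intro: finite_subset)
  moreover have "\<forall>e\<in>induced E g A. g e \<subseteq> A \<and> card (g e) = r" "finite (induced E g A)"
    using assms(1) unfolding bounded_hypergraph_def induced_def by auto
  ultimately show ?thesis unfolding bounded_hypergraph_def using c d by simp
qed

text \<open>Each round either reaches \<open>few\<close> or loses \<open>\<delta>\<close> vertices.
  A set of at most \<open>t * \<delta>\<close> vertices is exhausted after \<open>t\<close> rounds,
  each of which multiplies the number of containers by \<open>M\<close>.\<close>

lemma containers_iterate:
  fixes E :: "'e set" and g :: "'e \<Rightarrow> 'v set"
  assumes fin: "finite W" and M: "1 \<le> M"
    and step: "\<And>A. A \<subseteq> W \<Longrightarrow> has_containers A (indep_sets A (induced E g A) g)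
        (\<lambda>C. few C \<or> real (card C) + \<delta> \<le> real (card A)) M"
    and few: "few {}"
    and A: "A \<subseteq> W" "real (card A) \<le> real t * \<delta>"
  shows "has_containers W {I\<in>indep_sets W E g. I \<subseteq> A} few (M ^ t)"
  using A
proof (induction t arbitrary: A)
  case 0
  then have "A = {}" using fin by (simp add: finite_subset)
  then show ?case by (intro has_containers_single[where C = "{}"]) (use few in auto)
next
  case (Suc t)
  let ?\<I> = "{I\<in>indep_sets W E g. I \<subseteq> A}"
  have "?\<I> \<subseteq> indep_sets A (induced E g A) g"
    unfolding indep_sets_def induced_def by auto
  then have 1: "has_containers W ?\<I> (\<lambda>C. few C \<or> real (card C) + \<delta> \<le> real (card A)) M"
    by (rule has_containers_mono[OF has_containers_superset[OF step[OF Suc.prems(1)] Suc.prems(1)]])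
       simp_all
  have Mt: "1 \<le> M ^ t" using M by (rule one_le_power)
  have "has_containers W ?\<I> few (M * M ^ t)"
  proof (rule has_containers_refine[OF 1 fin])
    fix C assume C: "C \<subseteq> W" "few C \<or> real (card C) + \<delta> \<le> real (card A)"
    show "has_containers W {I \<in> ?\<I>. I \<subseteq> C} few (M ^ t)"
    proof (cases "few C")
      case True
      then show ?thesis by (intro has_containers_single[where C = C]) (use C Mt in auto)
    next
      case False
      then have "real (card C) \<le> real t * \<delta>" using C(2) Suc.prems(2) by (simp add: algebra_simps)
      then show ?thesis by (rule has_containers_mono[OF Suc.IH[OF C(1)]]) auto
    qed
  qed (use Mt in simp)
  then show ?case by simp
qed

text \<open>First \<open>y\<close> is taken so large that the factor \<open>1 + 1/y\<close> per
  queried vertex uses half of the exponent, then \<open>\<tau>\<close> so small that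
  \<open>y ^ s\<close> uses the other half.\<close>

lemma tree_size_bound:
  assumes "0 < (\<zeta>::real)"
  shows "\<exists>y\<ge>1. \<exists>\<tau>>0. \<forall>a n s. a \<le> n \<longrightarrow> real s \<le> \<tau> * real n \<longrightarrow>
           (1 + 1/y) ^ a * y ^ s \<le> 2 powr (\<zeta> * real n)"
proof -
  define x where "x = 2 powr (\<zeta>/2) - 1"
  define y where "y = max 1 (1/x)"
  \<comment> \<open>The summand 1 keeps the denominator positive when \<open>y = 1\<close>.\<close>
  define \<tau> where "\<tau> = \<zeta> * ln 2 / (2 * (ln y + 1))"
  have x: "0 < x" unfolding x_def using assms by simp
  have y: "1 \<le> y" "1/y \<le> x" unfolding y_def using x by (auto simp: field_simps max_def)
  have lny: "0 \<le> ln y" using y by simp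
  have \<tau>: "0 < \<tau>" unfolding \<tau>_def using assms lny by simp
  have "\<tau> * ln y \<le> \<tau> * (ln y + 1)" using \<tau> by simp
  also have "\<dots> = \<zeta>/2 * ln 2" unfolding \<tau>_def using lny by (simp add: field_simps)
  finally have \<tau>y: "\<tau> * ln y \<le> \<zeta>/2 * ln 2" .
  have "(1 + 1/y) ^ a * y ^ s \<le> 2 powr (\<zeta> * real n)" if "a \<le> n" "real s \<le> \<tau> * real n" for a n s
  proof -
    have "(1 + 1/y) ^ a \<le> (1 + 1/y) ^ n" using y that by (intro power_increasing) auto
    also have "\<dots> \<le> (2 powr (\<zeta>/2)) ^ n" using y unfolding x_def by (intro power_mono) auto
    also have "\<dots> = 2 powr (\<zeta>/2 * real n)" by (simp add: powr_power mult.commute)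
    finally have 1: "(1 + 1/y) ^ a \<le> 2 powr (\<zeta>/2 * real n)" .
    have "y ^ s = exp (real s * ln y)" using y by (simp add: exp_of_nat_mult)
    also have "real s * ln y \<le> \<tau> * real n * ln y" using that lny by (intro mult_right_mono)
    also have "\<tau> * real n * ln y = real n * (\<tau> * ln y)" by simp
    also have "\<dots> \<le> real n * (\<zeta>/2 * ln 2)" using \<tau>y by (intro mult_left_mono) auto
    finally have 2: "y ^ s \<le> 2 powr (\<zeta>/2 * real n)" by (simp add: powr_def mult_ac)
    have "(1 + 1/y) ^ a * y ^ s \<le> 2 powr (\<zeta>/2 * real n) * 2 powr (\<zeta>/2 * real n)"
      using 1 2 y by (intro mult_mono) auto
    also have "\<dots> = 2 powr (\<zeta> * real n)" by (simp flip: powr_add)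
    finally show ?thesis .
  qed
  then show ?thesis using y(1) \<tau> by blast
qed

text \<open>The link of a full fingerprint has at least \<open>\<beta> * \<tau> * K * n\<close>
  edges. A container of the link holds at most half that number, and each edge it misses meets its
  complement; link degrees are at most \<open>2 * L' * \<tau> * K\<close>, so the complement has at
  least \<open>\<beta> / (4 * L') * n\<close> vertices.\<close>

lemma link_containers:
  fixes E :: "'e set" and g :: "'e \<Rightarrow> 'v set"
  assumes H: "bounded_hypergraph n (Suc r) (L * K) (\<kappa> * K) W E g"
    and st: "link_state E g (L' * \<tau> * K + \<kappa> * K) (\<beta> * K) S Q h"
    and S: "\<tau> * real n \<le> real (card S)"
    and \<kappa>: "\<kappa> \<le> L' * \<tau>" "\<kappa> \<le> \<kappa>' * \<tau>"
    and pos: "0 < K" "0 < \<tau>" "0 < L'" "0 < \<beta>" and \<xi>: "\<xi> \<le> \<beta> / 2"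
    and IH: "bounded_hypergraph n r (2 * L' * (\<tau> * K)) (\<kappa>' * (\<tau> * K)) W Q (link g h)
       \<Longrightarrow> admits_containers \<xi> (\<tau> * K) n W Q (link g h)"
  shows "has_containers W {I\<in>indep_sets W E g. S \<subseteq> I}
     (\<lambda>C. real (card C) + \<beta> / (4 * L') * real n \<le> real (card W)) (2 powr (\<xi> * real n))"
proof -
  have QE: "Q \<subseteq> E" and hQ: "\<And>e. e \<in> Q \<Longrightarrow> h e \<in> g e \<and> h e \<in> S"
    and degQ: "\<And>u. real (degree Q (link g h) u) \<le> L' * \<tau> * K + \<kappa> * K"
    and cQ: "real (card S) * (\<beta> * K) \<le> real (card Q)"
    using st unfolding link_state_def by auto
  have fin: "finite W" "finite E" "card W \<le> n"
    and unif: "\<And>e. e \<in> E \<Longrightarrow> g e \<subseteq> W \<and> card (g e) = Suc r"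
    and codeg: "\<And>u v. u \<noteq> v \<Longrightarrow> real (codegree E g u v) \<le> \<kappa> * K"
    using H unfolding bounded_hypergraph_def by auto
  have finQ: "finite Q" using QE fin finite_subset by blast
  \<comment> \<open>A link degree exceeds the threshold \<open>L' * \<tau> * K\<close> by at most
    one codegree, which doubling the constant absorbs.\<close>
  have "\<kappa> * K \<le> L' * \<tau> * K" using \<kappa>(1) pos by (intro mult_right_mono) auto
  then have deg: "real (degree Q (link g h) u) \<le> 2 * L' * (\<tau> * K)" for u
    using degQ[of u] by (simp add: mult.assoc)
  have "bounded_hypergraph n r (2 * L' * (\<tau> * K)) (\<kappa>' * (\<tau> * K)) W Q (link g h)"
    unfolding bounded_hypergraph_def
  proof (intro conjI ballI allI impI)
    fix e assume e: "e \<in> Q"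
    then have "g e \<subseteq> W" "card (g e) = Suc r" using unif QE by auto
    moreover have "finite (g e)" using \<open>g e \<subseteq> W\<close> fin finite_subset by blast
    ultimately show "link g h e \<subseteq> W" "card (link g h e) = r"
      using hQ[OF e] unfolding link_def by auto
  next
    fix u v :: 'v assume "u \<noteq> v"
    have "codegree Q (link g h) u v \<le> codegree E g u v"
      unfolding codegree_def link_def using fin QE by (intro card_mono) auto
    also have "real (codegree E g u v) \<le> \<kappa> * K" using codeg[OF \<open>u \<noteq> v\<close>] .
    also have "\<dots> \<le> \<kappa>' * \<tau> * K" using \<kappa>(2) pos by (intro mult_right_mono) auto
    finally show "real (codegree Q (link g h) u v) \<le> \<kappa>' * (\<tau> * K)" by (simp add: mult.assoc)
  qed (use fin finQ deg in auto)
  then have "has_containers W (indep_sets W Q (link g h))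
     (\<lambda>C. real (card (induced Q (link g h) C)) \<le> \<xi> * (\<tau> * K) * real n) (2 powr (\<xi> * real n))"
    using IH unfolding admits_containers_def by blast
  then show ?thesis
  proof (rule has_containers_mono)
    show "{I \<in> indep_sets W E g. S \<subseteq> I} \<subseteq> indep_sets W Q (link g h)"
    proof
      fix I assume I: "I \<in> {I \<in> indep_sets W E g. S \<subseteq> I}"
      have "\<not> link g h e \<subseteq> I" if "e \<in> Q" for e
      proof
        assume "link g h e \<subseteq> I"
        then have "g e \<subseteq> I" using hQ[OF that] I unfolding link_def by blast
        then show False using I that QE unfolding indep_sets_def by blast
      qed
      then show "I \<in> indep_sets W Q (link g h)" using I unfolding indep_sets_def by blast
    qed
  next
    fix C assume C: "C \<subseteq> W"
      "real (card (induced Q (link g h) C)) \<le> \<xi> * (\<tau> * K) * real n"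
    let ?R = "Q - induced Q (link g h) C"
    have meet: "link g h e \<inter> (W - C) \<noteq> {}" if "e \<in> ?R" for e
    proof -
      have "link g h e \<subseteq> W" using that unif[of e] QE unfolding link_def by auto
      then show ?thesis using that unfolding induced_def by blast
    qed
    have "\<tau> * real n * (\<beta> * K) \<le> real (card Q)"
      by (rule order_trans[OF mult_right_mono[OF S] cQ]) (use pos in simp)
    also have "card Q = card (induced Q (link g h) C) + card ?R"
      using finQ card_mono[of Q "induced Q (link g h) C"] by (subst card_Diff_subset) (auto simp: induced_def)
    also have "real \<dots> \<le> \<beta>/2 * (\<tau> * K) * real n + real (card ?R)"
    proof -
      have "\<xi> * (\<tau> * K) * real n \<le> \<beta>/2 * (\<tau> * K) * real n"
        using \<xi> pos by (intro mult_right_mono) auto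
      then show ?thesis using C(2) by linarith
    qed
    also have "real (card ?R) \<le> real (card (W - C)) * (2 * L' * (\<tau> * K))"
      using fin finQ meet deg by (intro card_meeting_le[where E = Q and g = "link g h"]) auto
    finally have "(\<tau> * K) * (\<beta> / 2 * real n) \<le> (\<tau> * K) * (real (card (W - C)) * (2 * L'))"
      by (simp add: field_simps)
    then have "\<beta> / 2 * real n \<le> real (card (W - C)) * (2 * L')"
      using pos by (simp add: mult_le_cancel_left_pos)
    then have "\<beta> / (4 * L') * real n \<le> real (card (W - C))"
      using pos by (simp add: field_simps)
    moreover have "card (W - C) + card C = card W"
      using C(1) fin card_mono[of W C] by (subst card_Diff_subset) (auto intro: finite_subset)
    ultimately show "real (card C) + \<beta> / (4 * L') * real n \<le> real (card W)"
      by linarith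
  qed simp
qed

text \<open>An edge inside \<open>A \<union> S\<close> that is not in the unsaturated family meets
  \<open>S\<close> or the set \<open>T\<close> of saturated vertices. Both sets are small and
  degrees are at most \<open>L * K\<close>, so each accounts for at most a quarter of the allowed
  edges.\<close>

lemma few_edges_of_unsaturated:
  fixes E :: "'e set" and g :: "'e \<Rightarrow> 'v set"
  assumes H: "bounded_hypergraph n (Suc r) (L * K) c W E g"
    and st: "link_state E g D d S Q h"
    and sub: "A \<subseteq> W" "S \<subseteq> W" and S: "real (card S) \<le> 2 * \<tau> * real n"
    and few: "real (card (unsaturated E g (L' * \<tau> * K) Q h A)) \<le> \<epsilon> / 2 * K * real n"
    and pos: "0 < K" "0 < \<tau>" "0 < L" "0 < \<epsilon>" "0 < L'"
    and L': "8 * real (Suc r) * L\<^sup>2 \<le> \<epsilon> * L'" and \<tau>: "8 * \<tau> * L \<le> \<epsilon>"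
  shows "real (card (induced E g (A \<union> S))) \<le> \<epsilon> * K * real n"
proof -
  have QE: "Q \<subseteq> E" and hQ: "\<And>e. e \<in> Q \<Longrightarrow> h e \<in> g e \<and> h e \<in> S"
    using st unfolding link_state_def by auto
  have fin: "finite W" "finite E"
    and unif: "\<And>e. e \<in> E \<Longrightarrow> g e \<subseteq> W \<and> card (g e) = Suc r"
    and deg: "\<And>v. real (degree E g v) \<le> L * K"
    using H unfolding bounded_hypergraph_def by auto
  have finQ: "finite Q" using QE fin finite_subset by blast
  have finS: "finite S" using sub fin finite_subset by blast
  define T where "T = {u \<in> W. L' * \<tau> * K \<le> real (degree Q (link g h) u)}"
  have finT: "finite T" using fin unfolding T_def by simp
  have Q: "real (card Q) \<le> real (card S) * (L * K)"
    using finS fin QE hQ deg by (intro card_meeting_le[where E = E and g = g]) auto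
  have "real (card T) * (L' * \<tau> * K) \<le> real (Suc r) * real (card Q)"
  proof (rule card_high_degree_le[OF finT finQ])
    fix e assume e: "e \<in> Q"
    then have "finite (g e)" using unif[of e] QE fin finite_subset by blast
    then show "card (link g h e) \<le> Suc r \<and> finite (link g h e)"
      using unif[of e] QE e card_mono[of "g e" "link g h e"] unfolding link_def by auto
  qed (simp add: T_def)
  also have "\<dots> \<le> real (Suc r) * (2 * \<tau> * real n * (L * K))"
    by (rule mult_left_mono[OF order_trans[OF Q mult_right_mono[OF S]]]) (use pos in simp_all)
  \<comment> \<open>The bound on the number of collected edges and the saturation threshold are both
    proportional to \<open>\<tau>\<close>, so \<open>\<tau>\<close> cancels. Thus \<open>L'\<close>
    can be fixed before \<open>\<tau>\<close>.\<close>
  finally have "(\<tau> * K) * (real (card T) * L') \<le> (\<tau> * K) * (real (Suc r) * (2 * real n * L))"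
    by (simp only: mult_ac)
  then have T: "real (card T) * L' \<le> real (Suc r) * (2 * real n * L)"
    using pos by (simp only: mult_le_cancel_left_pos mult_pos_pos)
  have "(real (card T) * (L * K)) * L' = (real (card T) * L') * (L * K)" by simp
  also have "\<dots> \<le> real (Suc r) * (2 * real n * L) * (L * K)"
    using T pos by (intro mult_right_mono) auto
  also have "\<dots> = (8 * real (Suc r) * L\<^sup>2) * (real n * K / 4)" by (simp add: power2_eq_square)
  also have "\<dots> \<le> (\<epsilon> * L') * (real n * K / 4)"
    using L' pos by (intro mult_right_mono) auto
  also have "\<dots> = (\<epsilon> / 4 * K * real n) * L'" by simp
  finally have T4: "real (card T) * (L * K) \<le> \<epsilon> / 4 * K * real n"
    using pos by (simp only: mult_le_cancel_right_pos)
  have "real (card S) * (L * K) \<le> 2 * \<tau> * real n * (L * K)"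
    using S pos by (intro mult_right_mono) auto
  also have "\<dots> = (8 * \<tau> * L) * (K * real n / 4)" by simp
  also have "\<dots> \<le> \<epsilon> * (K * real n / 4)" using \<tau> pos by (intro mult_right_mono) auto
  finally have S4: "real (card S) * (L * K) \<le> \<epsilon> / 4 * K * real n" by simp
  let ?U = "unsaturated E g (L' * \<tau> * K) Q h A"
  define ES where "ES = {e \<in> E. g e \<inter> S \<noteq> {}}"
  define ET where "ET = {e \<in> E. g e \<inter> T \<noteq> {}}"
  have "real (card ES) \<le> real (card S) * (L * K)"
    using finS fin deg by (intro card_meeting_le[where E = E and g = g]) (auto simp: ES_def)
  moreover have "real (card ET) \<le> real (card T) * (L * K)"
    using finT fin deg by (intro card_meeting_le[where E = E and g = g]) (auto simp: ET_def)
  moreover have "induced E g (A \<union> S) \<subseteq> ?U \<union> (ES \<union> ET)"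
  proof
    fix e assume "e \<in> induced E g (A \<union> S)"
    then have e: "e \<in> E" "g e \<subseteq> A \<union> S" unfolding induced_def by auto
    show "e \<in> ?U \<union> (ES \<union> ET)"
    proof (cases "e \<in> ES \<or> e \<in> ET")
      case False
      then have "g e \<inter> S = {}" "g e \<inter> T = {}" using e(1) unfolding ES_def ET_def by auto
      then have "g e \<subseteq> A" "\<forall>u\<in>g e. u \<notin> T" using e(2) by blast+
      then have "e \<in> ?U" using e(1) sub(1) unfolding unsaturated_def T_def by force
      then show ?thesis by blast
    qed blast
  qed
  then have "card (induced E g (A \<union> S)) \<le> card (?U \<union> (ES \<union> ET))"
    using fin unfolding unsaturated_def ES_def ET_def by (intro card_mono) auto
  then have "card (induced E g (A \<union> S)) \<le> card ?U + (card ES + card ET)"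
    using card_Un_le[of ?U "ES \<union> ET"] card_Un_le[of ES ET] by linarith
  then have "real (card (induced E g (A \<union> S))) \<le> real (card ?U) + (real (card ES) + real (card ET))"
    by linarith
  moreover have "\<epsilon> * K * real n = \<epsilon> / 2 * K * real n + (\<epsilon> / 4 * K * real n + \<epsilon> / 4 * K * real n)"
    by (simp add: field_simps)
  ultimately show ?thesis using few S4 T4 by linarith
qed

text \<open>
  The loss \<open>\<delta>\<close> is independent of \<open>\<zeta>\<close>; this is what makes the iteration over boundedly many rounds
  affordable.
\<close>

lemma container_step:
  fixes r :: nat and \<epsilon> L :: real
  assumes IH: "\<And>\<epsilon> L :: real. 0 < \<epsilon> \<Longrightarrow> 0 < L \<Longrightarrow> \<exists>\<kappa>>0. \<exists>n0. \<forall>n\<ge>n0. \<forall>K>0. \<forall>(W :: 'v set) (E :: 'e set) g.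
      bounded_hypergraph n r (L * K) (\<kappa> * K) W E g \<longrightarrow> admits_containers \<epsilon> K n W E g"
    and pos: "0 < \<epsilon>" "0 < L"
  shows "\<exists>\<delta>>0. \<forall>\<zeta>>0. \<exists>\<kappa>>0. \<exists>n0. \<forall>n\<ge>n0. \<forall>K>0. \<forall>(W :: 'v set) (E :: 'e set) g.
      bounded_hypergraph n (Suc r) (L * K) (\<kappa> * K) W E g \<longrightarrow>
      has_containers W (indep_sets W E g)
        (\<lambda>C. real (card (induced E g C)) \<le> \<epsilon> * K * real n \<or> real (card C) + \<delta> * real n \<le> real (card W))
        (2 powr (\<zeta> * real n))"
proof -
  \<comment> \<open>\<open>L'\<close> keeps saturated vertices few, \<open>\<beta>\<close> makes the
    averaging in the decision tree succeed while more than \<open>\<epsilon> / 2 * K * n\<close>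
    edges are unsaturated, and \<open>\<delta>\<close> is the resulting loss of vertices. Only
    \<open>\<epsilon>\<close>, \<open>L\<close> and \<open>r\<close> enter.\<close>
  define L' where "L' = 8 * real (Suc r) * L\<^sup>2 / \<epsilon>"
  define \<beta> where "\<beta> = \<epsilon> / 2"
  have pos': "0 < L'" "0 < \<beta>" unfolding L'_def \<beta>_def using pos by auto
  have L': "8 * real (Suc r) * L\<^sup>2 \<le> \<epsilon> * L'" unfolding L'_def using pos by simp
  define \<delta> where "\<delta> = \<beta> / (4 * L')"
  have \<delta>: "0 < \<delta>" unfolding \<delta>_def using pos' by simp
  have "\<exists>\<kappa>>0. \<exists>n0. \<forall>n\<ge>n0. \<forall>K>0. \<forall>(W :: 'v set) (E :: 'e set) g.
      bounded_hypergraph n (Suc r) (L * K) (\<kappa> * K) W E g \<longrightarrow>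
      has_containers W (indep_sets W E g)
        (\<lambda>C. real (card (induced E g C)) \<le> \<epsilon> * K * real n \<or> real (card C) + \<delta> * real n \<le> real (card W))
        (2 powr (\<zeta> * real n))" if \<zeta>: "0 < \<zeta>" for \<zeta>
  proof -
    \<comment> \<open>Half of \<open>\<zeta>\<close> pays for the decision tree, the other half for
      the containers of the link. The bound \<open>\<beta> / 2\<close> limits these to half of the
      guaranteed link edges.\<close>
    define \<xi> where "\<xi> = min (\<zeta> / 2) (\<beta> / 2)"
    have \<xi>: "0 < \<xi>" "\<xi> \<le> \<beta> / 2" "\<xi> \<le> \<zeta> / 2" unfolding \<xi>_def using \<zeta> pos' by auto
    obtain \<kappa>' n1 where \<kappa>': "0 < \<kappa>'" and IH': "\<And>n K (W :: 'v set) (E :: 'e set) g. n1 \<le> n \<Longrightarrow> 0 < K \<Longrightarrow>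
        bounded_hypergraph n r (2 * L' * K) (\<kappa>' * K) W E g \<Longrightarrow> admits_containers \<xi> K n W E g"
      using IH[OF \<xi>(1), of "2 * L'"] mult_pos_pos[OF zero_less_numeral pos'(1)] by blast
    obtain y \<tau>0 where y: "1 \<le> y" and \<tau>0: "0 < \<tau>0"
      and size: "\<And>a n s. a \<le> n \<Longrightarrow> real s \<le> \<tau>0 * real n \<Longrightarrow>
           (1 + 1/y) ^ a * y ^ s \<le> 2 powr (\<zeta> / 2 * real n)"
      using tree_size_bound[of "\<zeta> / 2"] \<zeta> half_gt_zero by blast
    \<comment> \<open>The fingerprint size \<open>s\<close> is \<open>\<tau> * n\<close> rounded up,
      hence at most \<open>2 * \<tau> * n\<close> once \<open>n \<ge> 1 / \<tau>\<close>; this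
      explains the factor 2 against \<open>\<tau>0\<close>. The second term limits the edges meeting
      \<open>S\<close>.\<close>
    define \<tau> where "\<tau> = min (\<tau>0 / 2) (\<epsilon> / (8 * L))"
    have \<tau>: "0 < \<tau>" "2 * \<tau> \<le> \<tau>0" unfolding \<tau>_def using \<tau>0 pos by auto
    have "\<tau> \<le> \<epsilon> / (8 * L)" unfolding \<tau>_def by simp
    then have \<tau>L: "8 * \<tau> * L \<le> \<epsilon>" using pos by (simp add: field_simps)
    \<comment> \<open>The first term absorbs the overshoot of a link degree; the second makes the
      codegrees of the link at most \<open>\<kappa>' * (\<tau> * K)\<close>, as required at its own
      scale.\<close>
    define \<kappa> where "\<kappa> = min (L' * \<tau>) (\<kappa>' * \<tau>)"
    have \<kappa>: "0 < \<kappa>" "\<kappa> \<le> L' * \<tau>" "\<kappa> \<le> \<kappa>' * \<tau>" unfolding \<kappa>_def using pos' \<tau> \<kappa>' by auto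
    define n0 where "n0 = max n1 (nat \<lceil>1 / \<tau>\<rceil>)"
    have "has_containers W (indep_sets W E g)
        (\<lambda>C. real (card (induced E g C)) \<le> \<epsilon> * K * real n \<or> real (card C) + \<delta> * real n \<le> real (card W))
        (2 powr (\<zeta> * real n))"
      if n: "n0 \<le> n" and K: "0 < K" and H: "bounded_hypergraph n (Suc r) (L * K) (\<kappa> * K) W E g"
      for n K and W :: "'v set" and E :: "'e set" and g
    proof -
      let ?P = "\<lambda>C. real (card (induced E g C)) \<le> \<epsilon> * K * real n \<or> real (card C) + \<delta> * real n \<le> real (card W)"
      have fin: "finite W" "finite E" "card W \<le> n"
        and unif: "\<And>e. e \<in> E \<Longrightarrow> g e \<subseteq> W \<and> card (g e) = Suc r"
        and codeg: "\<And>u v. u \<noteq> v \<Longrightarrow> real (codegree E g u v) \<le> \<kappa> * K"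
        using H unfolding bounded_hypergraph_def by auto
      define s where "s = nat \<lceil>\<tau> * real n\<rceil>"
      have "1 / \<tau> \<le> real n" using n unfolding n0_def by linarith
      then have "1 \<le> \<tau> * real n" using \<tau> by (simp add: field_simps)
      then have s: "\<tau> * real n \<le> real s" "real s \<le> 2 * \<tau> * real n"
        unfolding s_def by linarith+
      have "has_containers W {I\<in>indep_sets W E g. {} \<subseteq> I \<and> I \<subseteq> W \<union> {}} ?P
          (2 powr (\<xi> * real n) * (1 + 1/y) ^ card W * y ^ (s - card ({} :: 'v set)))"
      proof (rule container_tree[where E = E and g = g and c = "\<kappa> * K" and d = "\<beta> * K"
            and U = "\<epsilon> / 2 * K * real n" and \<theta> = "L' * \<tau> * K" and Q = "{}" and h = undefined])
        show "g e \<noteq> {}" if "e \<in> E" for e using unif[OF that] by auto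
        show "real (card W) * (\<beta> * K) \<le> \<epsilon> / 2 * K * real n"
          using mult_right_mono[of "real (card W)" "real n" "\<epsilon> / 2 * K"] fin pos K
          unfolding \<beta>_def by (simp add: mult_ac)
        show "1 \<le> 2 powr (\<xi> * real n)" using \<xi> by (simp add: ge_one_powr_ge_zero)
        show "link_state E g (L' * \<tau> * K + \<kappa> * K) (\<beta> * K) {} {} undefined"
          unfolding link_state_def degree_def using pos' \<tau> \<kappa> K by simp
        show "has_containers W {I \<in> indep_sets W E g. S \<subseteq> I} ?P (2 powr (\<xi> * real n))"
          if "S \<subseteq> W" "card S = s" "link_state E g (L' * \<tau> * K + \<kappa> * K) (\<beta> * K) S Q h" for S Q h
        proof (rule has_containers_mono[OF link_containers[OF H that(3) _ \<kappa>(2,3) K \<tau>(1) pos' \<xi>(2)]])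
          show "\<tau> * real n \<le> real (card S)" using that s by simp
          show "admits_containers \<xi> (\<tau> * K) n W Q (link g h)"
            if "bounded_hypergraph n r (2 * L' * (\<tau> * K)) (\<kappa>' * (\<tau> * K)) W Q (link g h)"
            by (rule IH'[OF _ _ that]) (use n K \<tau> in \<open>auto simp: n0_def\<close>)
        qed (simp_all add: \<delta>_def)
        show "?P (A \<union> S)"
          if "A \<subseteq> W" "S \<subseteq> W" "card S \<le> s" "link_state E g (L' * \<tau> * K + \<kappa> * K) (\<beta> * K) S Q h"
            "real (card (unsaturated E g (L' * \<tau> * K) Q h A)) \<le> \<epsilon> / 2 * K * real n" for A S Q h
        proof (rule disjI1, rule few_edges_of_unsaturated[OF H that(4,1,2) _ that(5) K \<tau>(1) pos(2,1) pos'(1) L' \<tau>L])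
          show "real (card S) \<le> 2 * \<tau> * real n" using that(3) s by linarith
        qed
      qed (use fin codeg pos' K y in auto)
      then show ?thesis
      proof (rule has_containers_mono)
        show "indep_sets W E g \<subseteq> {I \<in> indep_sets W E g. {} \<subseteq> I \<and> I \<subseteq> W \<union> {}}"
          unfolding indep_sets_def by auto
        have "real s \<le> \<tau>0 * real n"
          using s(2) mult_right_mono[OF \<tau>(2), of "real n"] by simp
        moreover have "2 powr (\<xi> * real n) \<le> 2 powr (\<zeta> / 2 * real n)"
          using \<xi>(3) by (intro powr_mono mult_right_mono) auto
        ultimately
        have "2 powr (\<xi> * real n) * ((1 + 1/y) ^ card W * y ^ s)
            \<le> 2 powr (\<zeta> / 2 * real n) * 2 powr (\<zeta> / 2 * real n)"
          using size[OF fin(3)] y by (intro mult_mono) auto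
        also have "\<dots> = 2 powr (\<zeta> * real n)" by (simp flip: powr_add)
        finally show "2 powr (\<xi> * real n) * (1 + 1/y) ^ card W * y ^ (s - card ({} :: 'v set))
            \<le> 2 powr (\<zeta> * real n)" by (simp add: mult.assoc)
      qed
    qed
    then show ?thesis using \<kappa>(1) by blast
  qed
  then show ?thesis using \<delta> by blast
qed

text \<open>The induction covers all \<open>\<epsilon>\<close> and \<open>L\<close>, since the link,
  of smaller uniformity, is used with degree constant \<open>2 * L'\<close> and accuracy
  \<open>\<xi>\<close>.\<close>

lemma bounded_hypergraph_containers:
  fixes \<epsilon> L :: real
  assumes "0 < \<epsilon>" "0 < L"
  shows "\<exists>\<kappa>>0. \<exists>n0. \<forall>n\<ge>n0. \<forall>K>0. \<forall>(W :: 'v set) (E :: 'e set) g.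
      bounded_hypergraph n r (L * K) (\<kappa> * K) W E g \<longrightarrow> admits_containers \<epsilon> K n W E g"
  using assms
proof (induction r arbitrary: \<epsilon> L)
  case 0
  \<comment> \<open>An empty edge lies in every set, so without independent sets no container is needed.\<close>
  have "admits_containers \<epsilon> K n W E g"
    if K: "0 < K" and H: "bounded_hypergraph n 0 (L * K) (1 * K) W E g"
    for n K and W :: "'v set" and E :: "'e set" and g
  proof (cases "E = {}")
    case True
    then show ?thesis unfolding admits_containers_def
      by (intro has_containers_single[where C = W])
         (use 0 K in \<open>auto simp: indep_sets_def induced_def ge_one_powr_ge_zero\<close>)
  next
    case False
    then obtain e where "e \<in> E" by blast
    then have "g e = {}" using H finite_subset unfolding bounded_hypergraph_def by fastforce
    then show ?thesis unfolding admits_containers_def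
      by (intro has_containers_empty) (use \<open>e \<in> E\<close> in \<open>auto simp: indep_sets_def\<close>)
  qed
  then show ?case by (intro exI[of _ 1]) auto
next
  case (Suc r)
  obtain \<delta> where \<delta>: "0 < \<delta>" and step: "\<And>\<zeta>. 0 < \<zeta> \<Longrightarrow> \<exists>\<kappa>>0. \<exists>n0. \<forall>n\<ge>n0. \<forall>K>0.
      \<forall>(W :: 'v set) (E :: 'e set) g. bounded_hypergraph n (Suc r) (L * K) (\<kappa> * K) W E g \<longrightarrow>
      has_containers W (indep_sets W E g)
        (\<lambda>C. real (card (induced E g C)) \<le> \<epsilon> * K * real n \<or> real (card C) + \<delta> * real n \<le> real (card W))
        (2 powr (\<zeta> * real n))"
    using container_step[where 'v = 'v and 'e = 'e, OF Suc.IH Suc.prems] by blast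
  \<comment> \<open>Each round removes \<open>\<delta> * n\<close> of at most \<open>n\<close>
    vertices, so \<open>t\<close> rounds suffice, and each gets the share
    \<open>\<zeta> = \<epsilon> / t\<close> of the exponent. This is where \<open>\<delta>\<close>
    must be known before \<open>\<zeta>\<close>.\<close>
  define t where "t = nat \<lceil>1 / \<delta>\<rceil>"
  have "1 / \<delta> \<le> real t" unfolding t_def by linarith
  then have t\<delta>: "1 \<le> real t * \<delta>" using \<delta> by (simp add: field_simps)
  then have t: "0 < real t" by (cases "t = 0") auto
  define \<zeta> where "\<zeta> = \<epsilon> / real t"
  have \<zeta>: "0 < \<zeta>" unfolding \<zeta>_def using t Suc.prems by simp
  obtain \<kappa> n0 where \<kappa>: "0 < \<kappa>" and stp: "\<And>n K (W :: 'v set) (E :: 'e set) g. n0 \<le> n \<Longrightarrow> 0 < K \<Longrightarrow>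
      bounded_hypergraph n (Suc r) (L * K) (\<kappa> * K) W E g \<Longrightarrow>
      has_containers W (indep_sets W E g)
        (\<lambda>C. real (card (induced E g C)) \<le> \<epsilon> * K * real n \<or> real (card C) + \<delta> * real n \<le> real (card W))
        (2 powr (\<zeta> * real n))"
    using step[OF \<zeta>] by blast
  have "admits_containers \<epsilon> K n W E g"
    if n: "n0 \<le> n" and K: "0 < K" and H: "bounded_hypergraph n (Suc r) (L * K) (\<kappa> * K) W E g"
    for n K and W :: "'v set" and E :: "'e set" and g
  proof -
    let ?few = "\<lambda>C. real (card (induced E g C)) \<le> \<epsilon> * K * real n"
    have fin: "finite W" "card W \<le> n"
      and unif: "\<And>e. e \<in> E \<Longrightarrow> g e \<subseteq> W \<and> card (g e) = Suc r"
      using H unfolding bounded_hypergraph_def by auto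
    have "has_containers W {I\<in>indep_sets W E g. I \<subseteq> W} ?few ((2 powr (\<zeta> * real n)) ^ t)"
    proof (rule containers_iterate[where \<delta> = "\<delta> * real n"])
      fix A assume A: "A \<subseteq> W"
      show "has_containers A (indep_sets A (induced E g A) g)
         (\<lambda>C. ?few C \<or> real (card C) + \<delta> * real n \<le> real (card A)) (2 powr (\<zeta> * real n))"
      proof (rule has_containers_mono[OF stp[OF n K bounded_hypergraph_induced[OF H A]]])
        fix C assume "C \<subseteq> A"
        then have "induced (induced E g A) g C = induced E g C"
          unfolding induced_def by auto
        then show "real (card (induced (induced E g A) g C)) \<le> \<epsilon> * K * real n \<or>
              real (card C) + \<delta> * real n \<le> real (card A) \<Longrightarrow>
            ?few C \<or> real (card C) + \<delta> * real n \<le> real (card A)" by simp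
      qed simp_all
    next
      have "induced E g {} = {}" using unif unfolding induced_def by force
      then show "?few {}" using Suc.prems K by simp
      show "1 \<le> 2 powr (\<zeta> * real n)" using \<zeta> by (simp add: ge_one_powr_ge_zero)
      have "real (card W) \<le> 1 * real n" using fin by simp
      also have "\<dots> \<le> real t * \<delta> * real n" using t\<delta> by (intro mult_right_mono) auto
      finally show "real (card W) \<le> real t * (\<delta> * real n)" by (simp add: mult.assoc)
    qed (use fin in auto)
    then show ?thesis unfolding admits_containers_def
    proof (rule has_containers_mono)
      show "(2 powr (\<zeta> * real n)) ^ t \<le> 2 powr (\<epsilon> * real n)"
        unfolding \<zeta>_def using t by (simp add: powr_power)
    qed (auto simp: indep_sets_def)
  qed
  then show ?case using \<kappa> by blast
qed

section \<open>Removing the degree bound\<close>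

text \<open>
  Vertices of large degree are so few that the trace \<open>B'\<close> of the independent set on them can be
  prescribed; what remains of the edges has bounded degree but various sizes \<open>j\<close>.
\<close>

lemma uniform_hypergraph_containers:
  fixes \<epsilon> :: real and r :: nat
  assumes \<epsilon>: "0 < \<epsilon>"
  shows "\<exists>\<kappa>>0. \<exists>n0. \<forall>n\<ge>n0. \<forall>K>0. \<forall>(W :: 'v set) (E :: 'e set) g.
      finite W \<longrightarrow> card W \<le> n \<longrightarrow> finite E \<longrightarrow> (\<forall>e\<in>E. g e \<subseteq> W \<and> card (g e) = r) \<longrightarrow>
      real (card E) \<le> K * real n \<longrightarrow>
      (\<forall>u v. u \<noteq> v \<longrightarrow> real (codegree E g u v) \<le> \<kappa> * K) \<longrightarrow> admits_containers \<epsilon> K n W E g"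
proof -
  \<comment> \<open>Half of the exponent pays for the trace on the high-degree set \<open>B\<close>,
    since \<open>L\<close> forces \<open>card B \<le> \<epsilon> / 2 * n\<close>. The other half is
    shared by the \<open>r + 1\<close> possible sizes of a reduced edge, whence
    \<open>\<eta>\<close>.\<close>
  define \<eta> where "\<eta> = \<epsilon> / (2 * real (Suc r))"
  define L where "L = 2 * real (Suc r) / \<epsilon>"
  have \<eta>: "0 < \<eta>" and L: "0 < L" unfolding \<eta>_def L_def using \<epsilon> by auto
  have "\<forall>j. \<exists>\<kappa> n0. 0 < \<kappa> \<and> (\<forall>n\<ge>n0. \<forall>K>0. \<forall>(W :: 'v set) (E :: 'e set) g.
      bounded_hypergraph n j (L * K) (\<kappa> * K) W E g \<longrightarrow> admits_containers \<eta> K n W E g)"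
    using bounded_hypergraph_containers[OF \<eta> L, where 'v = 'v and 'e = 'e] by blast
  then obtain \<kappa>' n' where \<kappa>': "\<And>j. 0 < \<kappa>' j"
    and CT: "\<And>j n K (W :: 'v set) (E :: 'e set) g. n' j \<le> n \<Longrightarrow> 0 < K \<Longrightarrow>
      bounded_hypergraph n j (L * K) (\<kappa>' j * K) W E g \<Longrightarrow> admits_containers \<eta> K n W E g"
    by (metis (no_types))
  define \<kappa> where "\<kappa> = Min (\<kappa>' ` {..r})"
  define n0 where "n0 = Max (n' ` {..r})"
  have \<kappa>: "0 < \<kappa>" unfolding \<kappa>_def using \<kappa>' by (subst Min_gr_iff) auto
  have \<kappa>j: "\<kappa> \<le> \<kappa>' j" if "j \<le> r" for j unfolding \<kappa>_def using that by (intro Min_le) auto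
  have n0j: "n' j \<le> n0" if "j \<le> r" for j unfolding n0_def using that by (intro Max_ge) auto
  have "admits_containers \<epsilon> K n W E g"
    if n: "n0 \<le> n" and K: "0 < K" and fin: "finite W" "card W \<le> n" "finite E"
      and unif: "\<forall>e\<in>E. g e \<subseteq> W \<and> card (g e) = r" and cE: "real (card E) \<le> K * real n"
      and codeg: "\<forall>u v. u \<noteq> v \<longrightarrow> real (codegree E g u v) \<le> \<kappa> * K"
    for n K and W :: "'v set" and E :: "'e set" and g
  proof -
    define B where "B = {v \<in> W. L * K < real (degree E g v)}"
    have finB: "finite B" unfolding B_def using fin by simp
    have fing: "finite (g e)" if "e \<in> E" for e using unif fin(1) that finite_subset by blast
    have "real (card B) * (L * K) \<le> real r * real (card E)"
      using finB fin(3) unif fing by (intro card_high_degree_le[where g = g]) (auto simp: B_def)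
    also have "\<dots> \<le> real (Suc r) * (K * real n)" using cE by (intro mult_mono) auto
    finally have "K * (real (card B) * L) \<le> K * (real (Suc r) * real n)"
      by (simp only: mult_ac)
    then have "real (card B) * L \<le> real (Suc r) * real n"
      using K by (simp only: mult_le_cancel_left_pos)
    then have "real (Suc r) * (real (card B) * (2 / \<epsilon>)) \<le> real (Suc r) * real n"
      unfolding L_def by (simp only: times_divide_eq_left times_divide_eq_right mult_ac)
    then have "real (card B) * (2 / \<epsilon>) \<le> real n"
      by (simp only: mult_le_cancel_left_pos of_nat_0_less_iff zero_less_Suc)
    then have cB: "real (card B) \<le> \<epsilon> / 2 * real n" using \<epsilon> by (simp add: field_simps)
    have fixed: "has_containers W {I\<in>indep_sets W E g. I \<inter> B = B'}
        (\<lambda>C. real (card (induced E g C)) \<le> \<epsilon> * K * real n) ((2 powr (\<eta> * real n)) ^ Suc r)"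
      if B': "B' \<in> Pow B" for B'
    proof -
      let ?\<I> = "{I\<in>indep_sets W E g. I \<inter> B = B'}"
      \<comment> \<open>If the part of an edge in \<open>B\<close> lies in the prescribed trace
        \<open>B'\<close>, then it lies in \<open>I\<close>, so the remainder \<open>g' e\<close>
        cannot. Only such edges enter \<open>E'\<close>.\<close>
      define g' where "g' = (\<lambda>e. g e - B)"
      define E' where "E' = (\<lambda>j. {e \<in> E. g e \<inter> B \<subseteq> B' \<and> card (g' e) = j})"
      let ?P = "\<lambda>j C. real (card (induced (E' j) g' C)) \<le> \<eta> * K * real n"
      have E'E: "E' j \<subseteq> E" for j unfolding E'_def by auto
      have finE': "finite (E' j)" for j using E'E fin(3) finite_subset by blast
      have bh: "bounded_hypergraph n j (L * K) (\<kappa>' j * K) W (E' j) g'" if j: "j \<le> r" for j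
        unfolding bounded_hypergraph_def
      proof (intro conjI ballI allI impI)
        fix v
        show "real (degree (E' j) g' v) \<le> L * K"
        proof (cases "v \<in> W - B")
          case True
          have "degree (E' j) g' v \<le> degree E g v"
            unfolding degree_def g'_def using E'E fin by (intro card_mono) auto
          then show ?thesis using True unfolding B_def by auto
        next
          case False
          then have "{e \<in> E' j. v \<in> g' e} = {}" using unif E'E[of j] unfolding g'_def by auto
          then show ?thesis unfolding degree_def using L K by (simp only: card.empty) simp
        qed
      next
        fix u v :: 'v assume "u \<noteq> v"
        have "codegree (E' j) g' u v \<le> codegree E g u v"
          unfolding codegree_def g'_def using E'E fin by (intro card_mono) auto
        also have "real (codegree E g u v) \<le> \<kappa> * K" using codeg \<open>u \<noteq> v\<close> by blast
        also have "\<dots> \<le> \<kappa>' j * K" using \<kappa>j[OF j] K by (intro mult_right_mono) auto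
        finally show "real (codegree (E' j) g' u v) \<le> \<kappa>' j * K" by simp
      next
        fix e assume "e \<in> E' j"
        then show "g' e \<subseteq> W" "card (g' e) = j" using unif unfolding E'_def g'_def by auto
      qed (use fin finE' in auto)
      have sub: "?\<I> \<subseteq> indep_sets W (E' j) g'" for j
      proof
        fix I assume I: "I \<in> ?\<I>"
        have "\<not> g' e \<subseteq> I" if e: "e \<in> E' j" for e
        proof
          assume "g' e \<subseteq> I"
          moreover have "g e \<inter> B \<subseteq> I" using e I unfolding E'_def by blast
          ultimately have "g e \<subseteq> I" unfolding g'_def by blast
          then show False using I e unfolding indep_sets_def E'_def by blast
        qed
        then show "I \<in> indep_sets W (E' j) g'" using I unfolding indep_sets_def by blast
      qed
      have "has_containers W ?\<I> (\<lambda>C. \<forall>j<Suc r. ?P j C) ((2 powr (\<eta> * real n)) ^ Suc r)"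
      proof (rule has_containers_INT)
        fix j assume "j < Suc r"
        then have j: "j \<le> r" by simp
        have "admits_containers \<eta> K n W (E' j) g'"
          using CT[OF _ K bh[OF j]] n0j[OF j] n by simp
        then show "has_containers W ?\<I> (?P j) (2 powr (\<eta> * real n))"
          unfolding admits_containers_def by (rule has_containers_mono[OF _ sub]) auto
      next
        fix j C D assume "D \<subseteq> C" "?P j C"
        moreover have "card (induced (E' j) g' D) \<le> card (induced (E' j) g' C)"
          unfolding induced_def using finE' \<open>D \<subseteq> C\<close> by (intro card_mono) auto
        ultimately show "?P j D" by linarith
      qed (use fin in \<open>auto simp: indep_sets_def\<close>)
      then show ?thesis
      \<comment> \<open>Vertices of \<open>B - B'\<close> are known to be outside \<open>I\<close>.
        After their deletion every edge left in the container has its part in \<open>B\<close>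
        inside \<open>B'\<close>, so it is counted in one of the classes
        \<open>E' j\<close>.\<close>
      proof (rule has_containers_image[where f = "\<lambda>C. C - (B - B')"])
        fix C assume C: "C \<subseteq> W" "\<forall>j<Suc r. ?P j C"
        have "induced E g (C - (B - B')) \<subseteq> (\<Union>j\<in>{..r}. induced (E' j) g' C)"
        proof
          fix e assume "e \<in> induced E g (C - (B - B'))"
          then have e: "e \<in> E" "g e \<subseteq> C - (B - B')" unfolding induced_def by auto
          have "card (g' e) \<le> card (g e)" using fing[OF e(1)] unfolding g'_def by (intro card_mono) auto
          then have "card (g' e) \<le> r" using unif e(1) by simp
          moreover have "g e \<inter> B \<subseteq> B'" "g' e \<subseteq> C" using e(2) unfolding g'_def by blast+
          ultimately show "e \<in> (\<Union>j\<in>{..r}. induced (E' j) g' C)"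
            using e(1) unfolding induced_def E'_def by blast
        qed
        then have "card (induced E g (C - (B - B'))) \<le> card (\<Union>j\<in>{..r}. induced (E' j) g' C)"
          using finE' by (intro card_mono) (auto simp: induced_def)
        also have "\<dots> \<le> (\<Sum>j\<in>{..r}. card (induced (E' j) g' C))" by (rule card_UN_le) simp
        finally have "real (card (induced E g (C - (B - B'))))
            \<le> (\<Sum>j\<in>{..r}. real (card (induced (E' j) g' C)))"
          by (simp flip: of_nat_sum)
        also have "\<dots> \<le> real (card {..r}) * (\<eta> * K * real n)"
          using C(2) by (intro sum_bounded_above) auto
        also have "\<dots> = \<epsilon> / 2 * K * real n" unfolding \<eta>_def by (simp add: field_simps)
        also have "\<dots> \<le> \<epsilon> * K * real n" using \<epsilon> K by simp
        finally show "C - (B - B') \<subseteq> W \<and> real (card (induced E g (C - (B - B')))) \<le> \<epsilon> * K * real n"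
          using C(1) by blast
      qed (use fin in blast)+
    qed
    have "has_containers W (\<Union>B'\<in>Pow B. {I\<in>indep_sets W E g. I \<inter> B = B'})
        (\<lambda>C. real (card (induced E g C)) \<le> \<epsilon> * K * real n)
        (real (card (Pow B)) * (2 powr (\<eta> * real n)) ^ Suc r)"
      using finB fixed by (intro has_containers_UN) auto
    then show ?thesis unfolding admits_containers_def
    proof (rule has_containers_mono)
      show "indep_sets W E g \<subseteq> (\<Union>B'\<in>Pow B. {I\<in>indep_sets W E g. I \<inter> B = B'})"
        by (intro subsetI UN_I[of "_ \<inter> B"]) simp_all
    next
      have "real (card (Pow B)) = 2 powr real (card B)"
        using finB by (simp add: card_Pow powr_realpow)
      also have "\<dots> \<le> 2 powr (\<epsilon> / 2 * real n)" using cB by simp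
      finally have 1: "real (card (Pow B)) \<le> 2 powr (\<epsilon> / 2 * real n)" .
      have "(2 powr (\<eta> * real n)) ^ Suc r = 2 powr (real (Suc r) * (\<eta> * real n))"
        by (simp only: powr_power mult.commute)
      also have "real (Suc r) * (\<eta> * real n) = \<epsilon> / 2 * real n"
        unfolding \<eta>_def by (simp add: field_simps)
      finally have 2: "(2 powr (\<eta> * real n)) ^ Suc r = 2 powr (\<epsilon> / 2 * real n)" .
      have "real (card (Pow B)) * (2 powr (\<eta> * real n)) ^ Suc r
          \<le> 2 powr (\<epsilon> / 2 * real n) * 2 powr (\<epsilon> / 2 * real n)"
        unfolding 2 using 1 by (intro mult_right_mono) auto
      also have "\<dots> = 2 powr (\<epsilon> * real n)" by (simp flip: powr_add)
      finally show "real (card (Pow B)) * (2 powr (\<eta> * real n)) ^ Suc r \<le> 2 powr (\<epsilon> * real n)" .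
    qed
  qed
  then show ?thesis
    by (intro exI[of _ \<kappa>] conjI[OF \<kappa>] exI[of _ n0] allI impI) simp
qed

section \<open>Coloured embeddings\<close>

context ssee
begin

lemma finite_emb:
  assumes "N \<le> n"
  shows "finite (emb n N)"
proof (rule finite_subset)
  show "emb n N \<subseteq> V N \<rightarrow>\<^sub>E V n" using emb_maps assms by blast
  show "finite (V N \<rightarrow>\<^sub>E V n)" by (intro finite_PiE finite_V)
qed

lemma card_emb_image:
  assumes "N \<le> n" "\<phi> \<in> emb n N"
  shows "card (\<phi> ` V N) = card (V N)"
  using emb_inj[OF assms] by (rule card_image)

text \<open>\<open>J\<close> glues a pair of embeddings to one map on the disjoint union. Pulling
  back along \<open>Inl\<close> and \<open>Inr\<close> recovers the pair, so \<open>J\<close> is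
  injective.\<close>

lemma card_overlapping_pairs_le:
  assumes "N \<le> n"
  shows "card {(\<phi>, \<psi>). \<phi> \<in> emb n N \<and> \<psi> \<in> emb n N \<and>
            1 < card (\<phi> ` V N \<inter> \<psi> ` V N) \<and> card (\<phi> ` V N \<inter> \<psi> ` V N) < card (V N)}
         \<le> overlap_total V emb N n" (is "card ?P \<le> _")
proof -
  define R where "R = (\<lambda>i. {(\<phi>, \<psi>). \<phi> \<in> emb n N \<and> \<psi> \<in> emb n N \<and> card (\<phi> ` V N \<inter> \<psi> ` V N) = i})"
  define J where "J = (\<lambda>(\<phi>, \<psi>). \<lambda>z \<in> V N <+> V N. case_sum \<phi> \<psi> z :: 'a)"
  have JL: "J p (Inl x) = fst p x" and JR: "J p (Inr x) = snd p x" if "x \<in> V N" for p x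
    using that unfolding J_def by (auto simp: case_prod_beta)
  have ext: "\<phi> \<in> V N \<rightarrow>\<^sub>E V n" if "\<phi> \<in> emb n N" for \<phi> using emb_maps[OF assms that] .
  \<comment> \<open>Equality is also required off \<open>V N\<close>, where both sides are
    \<open>undefined\<close> because embeddings are extensional.\<close>
  have pbL: "pullback (V N) Inl (J p) = fst p" if "fst p \<in> emb n N" for p
  proof
    fix x show "pullback (V N) Inl (J p) x = fst p x"
      using JL[of x p] PiE_arb[OF ext[OF that], of x] unfolding pullback_def by simp
  qed
  have pbR: "pullback (V N) Inr (J p) = snd p" if "snd p \<in> emb n N" for p
  proof
    fix x show "pullback (V N) Inr (J p) x = snd p x"
      using JR[of x p] PiE_arb[OF ext[OF that], of x] unfolding pullback_def by simp
  qed
  have finR: "finite (R i)" for i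
    by (rule finite_subset[of _ "emb n N \<times> emb n N"]) (auto simp: R_def finite_emb assms)
  have R: "card (R i) \<le> overlap_count V emb N n i" for i
    unfolding overlap_count_def
  proof (rule card_inj_on_le[where f = J])
    show "inj_on J (R i)"
    proof (rule inj_onI)
      fix p q assume "p \<in> R i" "q \<in> R i" and eq: "J p = J q"
      then have "fst p \<in> emb n N" "snd p \<in> emb n N" "fst q \<in> emb n N" "snd q \<in> emb n N"
        unfolding R_def by auto
      then have "fst p = fst q" "snd p = snd q"
        using pbL[of p] pbL[of q] pbR[of p] pbR[of q] eq by simp_all
      then show "p = q" by (rule prod_eqI)
    qed
    show "finite {\<phi> \<in> V N <+> V N \<rightarrow>\<^sub>E V n. pullback (V N) Inl \<phi> \<in> emb n N \<and>
        pullback (V N) Inr \<phi> \<in> emb n N \<and> card (\<phi> ` Inl ` V N \<inter> \<phi> ` Inr ` V N) = i}"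
      by (rule finite_subset[of _ "V N <+> V N \<rightarrow>\<^sub>E V n", OF _ finite_PiE])
         (use finite_V in \<open>simp_all add: subset_iff\<close>)
    show "J ` R i \<subseteq> {\<phi> \<in> V N <+> V N \<rightarrow>\<^sub>E V n. pullback (V N) Inl \<phi> \<in> emb n N \<and>
        pullback (V N) Inr \<phi> \<in> emb n N \<and> card (\<phi> ` Inl ` V N \<inter> \<phi> ` Inr ` V N) = i}"
    proof
      fix j assume "j \<in> J ` R i"
      then obtain p where p: "p \<in> R i" "j = J p" by blast
      then have e: "fst p \<in> emb n N" "snd p \<in> emb n N" and c: "card (fst p ` V N \<inter> snd p ` V N) = i"
        unfolding R_def by auto
      have "J p \<in> V N <+> V N \<rightarrow>\<^sub>E V n"
      proof (rule PiE_I)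
        fix z assume "z \<in> V N <+> V N"
        then show "J p z \<in> V n"
          using PiE_mem[OF ext[OF e(1)]] PiE_mem[OF ext[OF e(2)]] by (elim PlusE) (simp_all add: JL JR)
      qed (simp add: J_def case_prod_beta)
      moreover have "J p ` Inl ` V N = fst p ` V N" "J p ` Inr ` V N = snd p ` V N"
        unfolding image_image by (simp_all add: JL JR cong: image_cong)
      ultimately show "j \<in> {\<phi> \<in> V N <+> V N \<rightarrow>\<^sub>E V n. pullback (V N) Inl \<phi> \<in> emb n N \<and>
          pullback (V N) Inr \<phi> \<in> emb n N \<and> card (\<phi> ` Inl ` V N \<inter> \<phi> ` Inr ` V N) = i}"
        using p(2) c e pbL[OF e(1)] pbR[OF e(2)] by simp
    qed
  qed
  have "?P \<subseteq> (\<Union>i\<in>{1<..<card (V N)}. R i)" unfolding R_def by auto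
  then have "card ?P \<le> card (\<Union>i\<in>{1<..<card (V N)}. R i)"
    using finR by (intro card_mono) auto
  also have "\<dots> \<le> (\<Sum>i\<in>{1<..<card (V N)}. card (R i))" by (rule card_UN_le) simp
  also have "\<dots> \<le> overlap_total V emb N n"
    unfolding overlap_total_def by (intro sum_mono R)
  finally show ?thesis .
qed

text \<open>
  Embeddings containing a pair of large codegree overlap with many others, so condition (iii) of a
  good ssee makes them negligible. Embeddings with equal image are not counted there, but a given
  image has at most \<open>card (V N) ^ card (V N)\<close> of them.
\<close>

definition heavy_embs :: "nat \<Rightarrow> nat \<Rightarrow> real \<Rightarrow> ('a \<Rightarrow> 'a) set" where
  "heavy_embs n N q = {\<phi> \<in> emb n N. \<exists>u\<in>\<phi> ` V N. \<exists>w\<in>\<phi> ` V N. u \<noteq> w \<and>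
     q < real (card {\<psi> \<in> emb n N. u \<in> \<psi> ` V N \<and> w \<in> \<psi> ` V N})}"

text \<open>Double counting of pairs with heavy first member \<open>\<phi>\<close>: of the more than
  \<open>q\<close> embeddings through some pair in its image, at most \<open>q / 2\<close> have the
  same image as \<open>\<phi>\<close>, and the others overlap it in the range counted by
  \<open>overlap_total\<close>.\<close>

lemma card_heavy_embs_le:
  assumes "N \<le> n" and q: "2 * real (card (V N) ^ card (V N)) \<le> q"
  shows "real (card (heavy_embs n N q)) * (q / 2) \<le> real (overlap_total V emb N n)"
proof -
  let ?r = "card (V N)"
  define Y where "Y = (\<lambda>\<phi>. {\<psi> \<in> emb n N. 1 < card (\<phi> ` V N \<inter> \<psi> ` V N) \<and>
    card (\<phi> ` V N \<inter> \<psi> ` V N) < ?r})"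
  have fin: "finite (emb n N)" using finite_emb assms(1) .
  have finY: "finite (Y \<phi>)" for \<phi> unfolding Y_def using fin by simp
  have finH: "finite (heavy_embs n N q)" unfolding heavy_embs_def using fin by simp
  have Y: "q / 2 \<le> real (card (Y \<phi>))" if heavy: "\<phi> \<in> heavy_embs n N q" for \<phi>
  proof -
    obtain u w where \<phi>: "\<phi> \<in> emb n N" and uw: "u \<in> \<phi> ` V N" "w \<in> \<phi> ` V N" "u \<noteq> w"
      and big: "q < real (card {\<psi> \<in> emb n N. u \<in> \<psi> ` V N \<and> w \<in> \<psi> ` V N})" (is "q < real (card ?X)")
      using heavy unfolding heavy_embs_def by blast
    have "?X \<subseteq> Y \<phi> \<union> (V N \<rightarrow>\<^sub>E \<phi> ` V N)"
    proof
      fix \<psi> assume \<psi>: "\<psi> \<in> ?X"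
      have "{u, w} \<subseteq> \<phi> ` V N \<inter> \<psi> ` V N" using \<psi> uw by blast
      then have "card {u, w} \<le> card (\<phi> ` V N \<inter> \<psi> ` V N)"
        using finite_V by (intro card_mono) auto
      then have gt: "1 < card (\<phi> ` V N \<inter> \<psi> ` V N)" using uw(3) by simp
      show "\<psi> \<in> Y \<phi> \<union> (V N \<rightarrow>\<^sub>E \<phi> ` V N)"
      proof (cases "card (\<phi> ` V N \<inter> \<psi> ` V N) < ?r")
        case True
        then show ?thesis using gt \<psi> unfolding Y_def by blast
      next
        case False
        have "\<phi> ` V N \<inter> \<psi> ` V N = \<psi> ` V N"
          using False card_emb_image[OF assms(1), of \<psi>] \<psi> finite_V
          by (intro card_seteq) simp_all
        then have "\<psi> ` V N \<subseteq> \<phi> ` V N" by blast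
        moreover have "\<psi> \<in> V N \<rightarrow>\<^sub>E V n" using emb_maps[OF assms(1)] \<psi> by blast
        ultimately have "\<psi> \<in> V N \<rightarrow>\<^sub>E \<phi> ` V N" by (auto simp: PiE_iff)
        then show ?thesis by blast
      qed
    qed
    then have "card ?X \<le> card (Y \<phi> \<union> (V N \<rightarrow>\<^sub>E \<phi> ` V N))"
      using finY finite_V by (intro card_mono) (auto intro!: finite_PiE)
    also have "\<dots> \<le> card (Y \<phi>) + card (V N \<rightarrow>\<^sub>E \<phi> ` V N)" by (rule card_Un_le)
    also have "card (V N \<rightarrow>\<^sub>E \<phi> ` V N) = ?r ^ ?r"
      using card_emb_image[OF assms(1) \<phi>] finite_V by (simp add: card_PiE)
    finally have "real (card ?X) \<le> real (card (Y \<phi>)) + real (?r ^ ?r)" by linarith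
    then show ?thesis using big q by linarith
  qed
  have "real (card (heavy_embs n N q)) * (q / 2) \<le> (\<Sum>\<phi>\<in>heavy_embs n N q. real (card (Y \<phi>)))"
    using Y by (intro sum_bounded_below) auto
  also have "\<dots> = real (card (SIGMA \<phi>:heavy_embs n N q. Y \<phi>))"
    using finH finY by (simp add: card_SigmaI)
  also have "\<dots> \<le> real (card {(\<phi>, \<psi>). \<phi> \<in> emb n N \<and> \<psi> \<in> emb n N \<and>
            1 < card (\<phi> ` V N \<inter> \<psi> ` V N) \<and> card (\<phi> ` V N \<inter> \<psi> ` V N) < card (V N)})"
    unfolding of_nat_le_iff
  proof (rule card_mono)
    show "finite {(\<phi>, \<psi>). \<phi> \<in> emb n N \<and> \<psi> \<in> emb n N \<and>
            1 < card (\<phi> ` V N \<inter> \<psi> ` V N) \<and> card (\<phi> ` V N \<inter> \<psi> ` V N) < card (V N)}"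
      by (rule finite_subset[of _ "emb n N \<times> emb n N"]) (use fin in auto)
  qed (auto simp: heavy_embs_def Y_def)
  also have "\<dots> \<le> real (overlap_total V emb N n)"
    using card_overlapping_pairs_le[OF assms(1)] by simp
  finally show ?thesis .
qed

text \<open>Edges are indexed by pairs because the theorem counts pairs: permuting
  \<open>V N\<close> simultaneously in \<open>\<phi>\<close> and \<open>f\<close> leaves the image
  unchanged.\<close>

definition coloured_image :: "nat \<Rightarrow> ('a \<Rightarrow> 'a) \<times> ('a \<Rightarrow> nat) \<Rightarrow> ('a \<times> nat) set" where
  "coloured_image N = (\<lambda>(\<phi>, f). (\<lambda>x. (\<phi> x, f x)) ` V N)"

text \<open>Distinct vertices of a common edge have distinct first coordinates. One light embedding
  through these coordinates bounds the number of all embeddings through them by \<open>q\<close>,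
  and each is combined with at most \<open>card F\<close> colourings.\<close>

lemma codegree_light_le:
  assumes "N \<le> n" "finite F" "0 \<le> q" "u \<noteq> v"
  shows "real (codegree ((emb n N - heavy_embs n N q) \<times> F) (coloured_image N) u v) \<le> real (card F) * q"
proof (cases "{e \<in> (emb n N - heavy_embs n N q) \<times> F. u \<in> coloured_image N e \<and> v \<in> coloured_image N e} = {}")
  case True
  then show ?thesis unfolding codegree_def using assms(3) by (simp only: card.empty) simp
next
  case False
  then obtain \<phi> f where e: "\<phi> \<in> emb n N" "\<phi> \<notin> heavy_embs n N q"
      "u \<in> coloured_image N (\<phi>, f)" "v \<in> coloured_image N (\<phi>, f)"
    by blast
  then obtain x y where xy: "x \<in> V N" "y \<in> V N" "u = (\<phi> x, f x)" "v = (\<phi> y, f y)"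
    unfolding coloured_image_def by auto
  have "x \<noteq> y" using xy(3,4) assms(4) by blast
  then have "\<phi> x \<noteq> \<phi> y" using emb_inj[OF assms(1) e(1)] xy by (meson inj_onD)
  then have ne: "fst u \<noteq> fst v" using xy by simp
  let ?X = "{\<psi> \<in> emb n N. fst u \<in> \<psi> ` V N \<and> fst v \<in> \<psi> ` V N}"
  have X: "real (card ?X) \<le> q"
    using e(1,2) ne xy unfolding heavy_embs_def by (auto simp: not_less)
  have fin: "finite ?X" using finite_emb[OF assms(1)] by simp
  have "codegree ((emb n N - heavy_embs n N q) \<times> F) (coloured_image N) u v \<le> card (?X \<times> F)"
    unfolding codegree_def using fin assms(2)
    by (intro card_mono) (auto simp: coloured_image_def)
  then have "real (codegree ((emb n N - heavy_embs n N q) \<times> F) (coloured_image N) u v)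
      \<le> real (card F) * real (card ?X)"
    by (simp add: card_cartesian_product mult.commute flip: of_nat_mult)
  also have "\<dots> \<le> real (card F) * q" using X by (intro mult_left_mono) auto
  finally show ?thesis .
qed

section \<open>From containers to templates\<close>

text \<open>A container is read as the template listing the colours present above each point. A pair
  realised by this template has a bad embedding or is an edge inside the container.\<close>

lemma templates_of_containers:
  assumes nN: "N \<le> n" and F: "F \<subseteq> colourings k (V N)"
    and cont: "admits_containers \<eta> K m (V n \<times> {1..k}) ((emb n N - Bad) \<times> F) (coloured_image N)"
    and Bad: "Bad \<subseteq> emb n N"
  shows "\<exists>T. T \<subseteq> templates k (V n) \<and>
           (\<forall>c\<in>Forb V emb k N F n. \<exists>t\<in>T. c \<in> realisations k (V n) t) \<and>
           (\<forall>t\<in>T. real (card {(\<phi>, c). \<phi> \<in> emb n N \<and> c \<in> F \<and>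
                        c \<in> realisations k (V N) (pullback (V N) \<phi> t)})
                    \<le> real (card Bad) * real (card F) + \<eta> * K * real m) \<and>
           real (card T) \<le> 2 powr (\<eta> * real m)"
proof -
  let ?W = "V n \<times> {1..k}" and ?E = "(emb n N - Bad) \<times> F" and ?g = "coloured_image N"
  have finF: "finite F"
    using F finite_V unfolding colourings_def by (meson finite_PiE finite_atLeastAtMost finite_subset)
  have finE: "finite ?E" using finite_emb[OF nN] finF by simp
  obtain \<C> where \<C>: "\<C> \<subseteq> Pow ?W" "real (card \<C>) \<le> 2 powr (\<eta> * real m)"
    and few: "\<forall>C\<in>\<C>. real (card (induced ?E ?g C)) \<le> \<eta> * K * real m"
    and cover: "\<forall>I\<in>indep_sets ?W ?E ?g. \<exists>C\<in>\<C>. I \<subseteq> C"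
    using cont unfolding admits_containers_def has_containers_def by (elim exE conjE)
  define tp where "tp = (\<lambda>C. \<lambda>v\<in>V n. {i \<in> {1..k}. (v, i) \<in> C})"
  \<comment> \<open>A container with no colour above some point gives no template, but it cannot
    contain the graph of a colouring either, so it is discarded.\<close>
  define T where "T = tp ` \<C> \<inter> templates k (V n)"
  have fin\<C>: "finite \<C>"
    using \<C>(1) finite_V by (meson finite_Pow_iff finite_SigmaI finite_atLeastAtMost finite_subset)
  have "card T \<le> card (tp ` \<C>)" unfolding T_def using fin\<C> by (intro card_mono) auto
  also have "\<dots> \<le> card \<C>" using fin\<C> by (rule card_image_le)
  finally have cT: "real (card T) \<le> 2 powr (\<eta> * real m)" using \<C>(2) by linarith
  have covT: "\<exists>t\<in>T. c \<in> realisations k (V n) t" if c: "c \<in> Forb V emb k N F n" for c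
  proof -
    have col: "c \<in> V n \<rightarrow>\<^sub>E {1..k}" and avoid: "\<And>\<phi>. \<phi> \<in> emb n N \<Longrightarrow> pullback (V N) \<phi> c \<notin> F"
      using c unfolding Forb_def colourings_def by auto
    let ?I = "(\<lambda>v. (v, c v)) ` V n"
    have "?I \<in> indep_sets ?W ?E ?g"
      unfolding indep_sets_def
    proof (intro CollectI conjI ballI notI)
      show "?I \<subseteq> ?W" using col by auto
      fix e assume e: "e \<in> ?E" "?g e \<subseteq> ?I"
      obtain \<phi> f where ef: "e = (\<phi>, f)" "\<phi> \<in> emb n N" "f \<in> F" using e(1) by blast
      have "c (\<phi> x) = f x" if "x \<in> V N" for x
      proof -
        have "(\<phi> x, f x) \<in> ?I" using e(2) that unfolding ef(1) coloured_image_def by auto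
        then show ?thesis by auto
      qed
      moreover have "f \<in> extensional (V N)" using F ef(3) unfolding colourings_def by (auto simp: PiE_def)
      ultimately have "pullback (V N) \<phi> c = f"
        unfolding pullback_def by (auto simp: extensional_def fun_eq_iff)
      then show False using avoid ef by blast
    qed
    then obtain C where C: "C \<in> \<C>" "?I \<subseteq> C" using cover by blast
    have mem: "c v \<in> tp C v" if "v \<in> V n" for v
      using C(2) col that unfolding tp_def by auto
    then have "tp C \<in> templates k (V n)"
      unfolding templates_def tp_def by (auto simp: PiE_iff)
    then have "tp C \<in> T" using C(1) unfolding T_def by blast
    moreover have "c \<in> realisations k (V n) (tp C)"
      using mem col unfolding realisations_def colourings_def by blast
    ultimately show ?thesis by blast
  qed
  have fewT: "real (card {(\<phi>, c). \<phi> \<in> emb n N \<and> c \<in> F \<and> c \<in> realisations k (V N) (pullback (V N) \<phi> t)})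
        \<le> real (card Bad) * real (card F) + \<eta> * K * real m" (is "real (card ?P) \<le> _") if t: "t \<in> T" for t
  proof -
    obtain C where C: "C \<in> \<C>" "t = tp C" using t unfolding T_def by blast
    have "?P \<subseteq> Bad \<times> F \<union> induced ?E ?g C"
    proof
      fix p assume "p \<in> ?P"
      then obtain \<phi> f where p: "p = (\<phi>, f)" "\<phi> \<in> emb n N" "f \<in> F"
        and real: "f \<in> realisations k (V N) (pullback (V N) \<phi> t)" by blast
      have "(\<phi> x, f x) \<in> C" if "x \<in> V N" for x
      proof -
        have "f x \<in> tp C (\<phi> x)" using real that C(2) unfolding realisations_def pullback_def by auto
        moreover have "\<phi> x \<in> V n" using emb_maps[OF nN p(2)] that by auto
        ultimately show ?thesis unfolding tp_def by simp
      qed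
      then have "?g p \<subseteq> C" unfolding p(1) coloured_image_def by auto
      then show "p \<in> Bad \<times> F \<union> induced ?E ?g C" using p unfolding induced_def by blast
    qed
    moreover have "finite (Bad \<times> F \<union> induced ?E ?g C)"
      using finE finF finite_subset[OF Bad finite_emb[OF nN]] unfolding induced_def by simp
    ultimately have "card ?P \<le> card (Bad \<times> F \<union> induced ?E ?g C)" by (rule card_mono[rotated])
    also have "\<dots> \<le> card (Bad \<times> F) + card (induced ?E ?g C)" by (rule card_Un_le)
    finally have "real (card ?P) \<le> real (card Bad) * real (card F) + real (card (induced ?E ?g C))"
      by (simp add: card_cartesian_product flip: of_nat_mult of_nat_add)
    then show ?thesis using few C(1) by fastforce
  qed
  have "T \<subseteq> templates k (V n)" unfolding T_def by blast
  then show ?thesis using covT fewT cT by blast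
qed

text \<open>One template lists all values taken by colourings in \<open>Forb\<close>. In these cases
  any \<open>f\<close> it realises along \<open>\<phi>\<close> is the pullback of a single member of
  \<open>Forb\<close>, hence not in \<open>F\<close>, so no pair occurs at all.\<close>

lemma templates_trivial:
  assumes nN: "N \<le> n" and small: "k \<le> 1 \<or> card (V N) \<le> 1" and ne: "V n \<noteq> {}"
    and F: "F \<subseteq> colourings k (V N)" and \<epsilon>: "0 < \<epsilon>"
  shows "\<exists>T. T \<subseteq> templates k (V n) \<and>
           (\<forall>c\<in>Forb V emb k N F n. \<exists>t\<in>T. c \<in> realisations k (V n) t) \<and>
           (\<forall>t\<in>T. real (card {(\<phi>, c). \<phi> \<in> emb n N \<and> c \<in> F \<and>
                        c \<in> realisations k (V N) (pullback (V N) \<phi> t)})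
                    \<le> \<epsilon> * real (card (emb n N))) \<and>
           real (card T) \<le> real k powr (\<epsilon> * real (card (V n)))"
proof (cases "Forb V emb k N F n = {}")
  \<comment> \<open>The empty family also settles \<open>k = 0\<close>, where
    \<open>real k powr x\<close> is 0 and a nonempty \<open>V n\<close> has no colouring.\<close>
  case True
  then show ?thesis by (intro exI[of _ "{}"]) auto
next
  case False
  then obtain c0 where c0: "c0 \<in> Forb V emb k N F n" by blast
  then have "c0 \<in> V n \<rightarrow>\<^sub>E {1..k}" unfolding Forb_def colourings_def by blast
  then have k: "1 \<le> k" using ne by fastforce
  define t where "t = (\<lambda>v\<in>V n. (\<lambda>c. c v) ` Forb V emb k N F n)"
  have col: "c \<in> V n \<rightarrow>\<^sub>E {1..k}" if "c \<in> Forb V emb k N F n" for c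
    using that unfolding Forb_def colourings_def by blast
  have t: "t \<in> templates k (V n)"
    unfolding templates_def t_def using c0 col by (fastforce simp: PiE_iff)
  have cov: "c \<in> realisations k (V n) t" if "c \<in> Forb V emb k N F n" for c
    using that col[OF that] unfolding realisations_def colourings_def t_def by auto
  have none: "\<not> f \<in> realisations k (V N) (pullback (V N) \<phi> t)" if \<phi>: "\<phi> \<in> emb n N" and f: "f \<in> F" for \<phi> f
  proof
    assume real: "f \<in> realisations k (V N) (pullback (V N) \<phi> t)"
    have \<phi>V: "\<phi> x \<in> V n" if "x \<in> V N" for x using emb_maps[OF nN \<phi>] that by auto
    have fcol: "f \<in> V N \<rightarrow>\<^sub>E {1..k}" using F f unfolding colourings_def by blast
    have ex: "\<exists>c\<in>Forb V emb k N F n. c (\<phi> x) = f x" if "x \<in> V N" for x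
    proof -
      have "f x \<in> t (\<phi> x)" using real that unfolding realisations_def pullback_def by simp
      then show ?thesis using \<phi>V[OF that] unfolding t_def by auto
    qed
    \<comment> \<open>\<open>ex\<close> gives a colouring for each \<open>x\<close> separately. A
      common one exists because all colours agree if \<open>k = 1\<close>, and otherwise there is at
      most one \<open>x\<close>.\<close>
    have "\<exists>c\<in>Forb V emb k N F n. \<forall>x\<in>V N. c (\<phi> x) = f x"
    proof (cases "k \<le> 1")
      case True
      then have "c0 (\<phi> x) = f x" if "x \<in> V N" for x
        using col[OF c0] fcol \<phi>V[OF that] that k by (metis PiE_mem atLeastAtMost_iff le_antisym le_trans)
      then show ?thesis using c0 by blast
    next
      case False
      then have "card (V N) \<le> Suc 0" using small by simp
      then have one: "x = y" if "x \<in> V N" "y \<in> V N" for x y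
        using that finite_V by (metis card_le_Suc0_iff_eq)
      show ?thesis
      proof (cases "V N = {}")
        case True
        then show ?thesis using c0 by blast
      next
        case False
        then obtain x where "x \<in> V N" by blast
        then show ?thesis using ex[of x] one by blast
      qed
    qed
    then obtain c where c: "c \<in> Forb V emb k N F n" "\<forall>x\<in>V N. c (\<phi> x) = f x" by blast
    then have "pullback (V N) \<phi> c = f"
      using fcol unfolding pullback_def by (auto simp: PiE_iff extensional_def fun_eq_iff)
    then show False using c(1) \<phi> f unfolding Forb_def by blast
  qed
  have "{(\<phi>, c). \<phi> \<in> emb n N \<and> c \<in> F \<and> c \<in> realisations k (V N) (pullback (V N) \<phi> t)} = {}"
    using none by blast
  then have few: "real (card {(\<phi>, c). \<phi> \<in> emb n N \<and> c \<in> F \<and> c \<in> realisations k (V N) (pullback (V N) \<phi> t)})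
      \<le> \<epsilon> * real (card (emb n N))"
    using \<epsilon> by (simp only: card.empty) simp
  have "1 \<le> real k powr (\<epsilon> * real (card (V n)))" using k \<epsilon> by (intro ge_one_powr_ge_zero) auto
  then show ?thesis using t cov few by (intro exI[of _ "{t}"]) simp
qed

end

section \<open>Choice of constants for a good ssee\<close>

theorem theorem3p18:
  fixes V :: "nat \<Rightarrow> 'a set"
    and emb :: "nat \<Rightarrow> nat \<Rightarrow> ('a \<Rightarrow> 'a) set"
    and k N :: nat
    and F :: "('a \<Rightarrow> nat) set"
    and \<epsilon> :: real
  assumes "good_ssee V emb"
    and "F \<subseteq> colourings k (V N)"
    and "F \<noteq> {}"
    and "\<epsilon> > 0"
  shows "\<exists>n0>0. \<forall>n\<ge>n0. \<exists>T. T \<subseteq> templates k (V n) \<and>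
           (\<forall>c\<in>Forb V emb k N F n. \<exists>t\<in>T. c \<in> realisations k (V n) t) \<and>
           (\<forall>t\<in>T. real (card {(\<phi>, c). \<phi> \<in> emb n N \<and> c \<in> F \<and>
                        c \<in> realisations k (V N) (pullback (V N) \<phi> t)})
                    \<le> \<epsilon> * real (card (emb n N))) \<and>
           real (card T) \<le> real k powr (\<epsilon> * real (card (V n)))"
    (is "\<exists>n0>0. \<forall>n\<ge>n0. ?good n")
proof -
  interpret good_ssee V emb by fact
  have large: "eventually (\<lambda>n. a \<le> card (V n)) sequentially" for a
    using card_V_at_top by (simp add: filterlim_at_top)
  have "eventually ?good sequentially"
  \<comment> \<open>For \<open>k \<le> 1\<close> at most one template is allowed, and for
    \<open>card (V N) \<le> 1\<close> the density and overlap conditions give no information; both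
    cases are treated directly.\<close>
  proof (cases "k \<le> 1 \<or> card (V N) \<le> 1")
    case True
    show ?thesis
      using eventually_ge_at_top[of N] large[of 1]
    proof eventually_elim
      case (elim n)
      then have "V n \<noteq> {}" by auto
      then show ?case using templates_trivial[OF elim(1) True _ assms(2,4)] by blast
    qed
  next
    case False
    let ?r = "card (V N)"
    have finF: "finite F"
      using assms(2) finite_V unfolding colourings_def
      by (meson finite_PiE finite_atLeastAtMost finite_subset)
    define p where "p = real (card F)"
    have p: "0 < p" unfolding p_def using finF assms(3) by (simp add: card_gt_0_iff)
    have k: "2 \<le> real k" using False by simp
    \<comment> \<open>The first term leaves half of the allowed pairs to the bad embeddings. The
      second offsets the factor \<open>k\<close> in the number \<open>k * card (V n)\<close> of
      vertices of the hypergraph.\<close>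
    define \<eta> where "\<eta> = min (\<epsilon> / (2 * p)) (\<epsilon> / real k)"
    have \<eta>: "0 < \<eta>" unfolding \<eta>_def using p k assms(4) by simp
    have "\<eta> \<le> \<epsilon> / (2 * p)" "\<eta> \<le> \<epsilon> / real k" unfolding \<eta>_def by auto
    then have \<eta>p: "\<eta> * p \<le> \<epsilon> / 2" and \<eta>k: "\<eta> * real k \<le> \<epsilon>" using p k by (simp_all add: field_simps)
    obtain \<kappa> n1 where \<kappa>: "0 < \<kappa>" and cont_all: "\<forall>n\<ge>n1. \<forall>K>0.
        \<forall>(W :: ('a \<times> nat) set) (E :: (('a \<Rightarrow> 'a) \<times> ('a \<Rightarrow> nat)) set) g.
        finite W \<longrightarrow> card W \<le> n \<longrightarrow> finite E \<longrightarrow> (\<forall>e\<in>E. g e \<subseteq> W \<and> card (g e) = ?r) \<longrightarrow>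
        real (card E) \<le> K * real n \<longrightarrow>
        (\<forall>u v. u \<noteq> v \<longrightarrow> real (codegree E g u v) \<le> \<kappa> * K) \<longrightarrow> admits_containers \<eta> K n W E g"
      using uniform_hypergraph_containers[OF \<eta>, where r = ?r and 'v = "'a \<times> nat" and 'e = "('a \<Rightarrow> 'a) \<times> ('a \<Rightarrow> nat)"]
      by (elim exE conjE)
    note cont = cont_all[THEN spec, THEN mp, THEN spec, THEN mp, THEN spec, THEN spec, THEN spec,
        THEN mp, THEN mp, THEN mp, THEN mp, THEN mp, THEN mp]
    \<comment> \<open>Chosen so that \<open>q\<close> below is at least \<open>2 * ?r ^ ?r\<close>;
      the summand 1 makes \<open>Z\<close> positive, which forces \<open>emb n N\<close> to be
      nonempty.\<close>
    define Z where "Z = 2 * real (?r ^ ?r) * real k / \<kappa> + 1"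
    have "1 < ?r" using False by simp
    then have "eventually (\<lambda>n. Z \<le> real (card (emb n N)) / real (card (V n))) sequentially"
      using emb_density[of N] by (simp add: filterlim_at_top)
    moreover have "eventually (\<lambda>n. real (card (V n)) * real (overlap_total V emb N n) /
        (real (card (emb n N)))\<^sup>2 < \<epsilon> * \<kappa> / (4 * real k * p)) sequentially"
      using overlap_small[OF \<open>1 < ?r\<close>] by (rule order_tendstoD) (use assms(4) \<kappa> p k in simp)
    ultimately show ?thesis
      using eventually_ge_at_top[of N] large[of 1] large[of n1]
    proof eventually_elim
      case (elim n)
      define v m I where "v = real (card (V n))" and "m = real (card (emb n N))"
        and "I = real (overlap_total V emb N n)"
      have v: "0 < v" unfolding v_def using elim by simp
      have "0 < Z" unfolding Z_def using \<kappa> k by (intro add_nonneg_pos) auto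
      then have "0 < m / v" using elim(1) unfolding m_def v_def by linarith
      then have m: "0 < m" using v by (simp add: zero_less_divide_iff)
      \<comment> \<open>\<open>K\<close> is the number \<open>p * m\<close> of all coloured
        embeddings divided by the number \<open>k * v\<close> of vertices. The threshold
        \<open>q\<close> is chosen so that the codegree bound \<open>p * q\<close> for light
        embeddings equals \<open>\<kappa> * K\<close>.\<close>
      define q where "q = \<kappa> * m / (real k * v)"
      define K where "K = p * m / (real k * v)"
      have q: "0 < q" and K: "0 < K" unfolding q_def K_def using \<kappa> m k v p by auto
      have \<kappa>K: "\<kappa> * K = p * q" unfolding q_def K_def by simp
      have "2 * real (?r ^ ?r) * real k / \<kappa> \<le> m / v"
        using elim(1) unfolding Z_def m_def v_def by linarith
      then have "2 * real (?r ^ ?r) * real k / \<kappa> * (\<kappa> / real k) \<le> m / v * (\<kappa> / real k)"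
        using \<kappa> k by (intro mult_right_mono) auto
      then have q_large: "2 * real (?r ^ ?r) \<le> q" unfolding q_def using \<kappa> k by (simp add: mult_ac)
      let ?Bad = "heavy_embs n N q"
      have "real (card ?Bad) * (q / 2) \<le> I"
        unfolding I_def by (rule card_heavy_embs_le[OF elim(3) q_large])
      then have "real (card ?Bad) * p * (v * q / 2) \<le> I * (v * p)"
        using v p by (simp add: mult_ac mult_le_cancel_left_pos)
      also have "v * I / m\<^sup>2 < \<epsilon> * \<kappa> / (4 * real k * p)"
        using elim(2) unfolding v_def I_def m_def .
      then have "v * I < \<epsilon> * \<kappa> / (4 * real k * p) * m\<^sup>2"
        using m by (simp add: pos_divide_less_eq)
      then have "v * I * p < \<epsilon> * \<kappa> / (4 * real k * p) * m\<^sup>2 * p"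
        using p by (intro mult_strict_right_mono)
      then have "I * (v * p) \<le> \<epsilon> * \<kappa> / (4 * real k * p) * m\<^sup>2 * p" by (simp add: mult_ac)
      also have "\<dots> = \<epsilon> / 2 * m * (v * q / 2)"
        unfolding q_def using p k v by (simp add: power2_eq_square field_simps)
      finally have bad: "real (card ?Bad) * p \<le> \<epsilon> / 2 * m"
        using v q by (simp add: mult_le_cancel_right_pos mult_ac)
      let ?W = "V n \<times> {1..k}" and ?E = "(emb n N - ?Bad) \<times> F" and ?g = "coloured_image N"
      let ?M = "k * card (V n)"
      have "admits_containers \<eta> K ?M ?W ?E ?g"
      proof (rule cont)
        have "1 * card (V n) \<le> ?M" using k by (intro mult_le_mono1) simp
        then show "n1 \<le> ?M" using elim(5) by linarith
        show "0 < K" by fact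
        show "finite ?W" using finite_V by simp
        show "card ?W \<le> ?M" by (simp add: card_cartesian_product)
        show "finite ?E" using finF finite_emb[OF elim(3)] by simp
        show "\<forall>e\<in>?E. ?g e \<subseteq> ?W \<and> card (?g e) = ?r"
        proof
          fix e assume "e \<in> ?E"
          then obtain \<phi> f where e: "e = (\<phi>, f)" "\<phi> \<in> emb n N" "f \<in> F" by blast
          have "\<phi> x \<in> V n \<and> f x \<in> {1..k}" if "x \<in> V N" for x
            using emb_maps[OF elim(3) e(2)] assms(2) e(3) that unfolding colourings_def by blast
          moreover have "inj_on (\<lambda>x. (\<phi> x, f x)) (V N)"
            using emb_inj[OF elim(3) e(2)] by (auto simp: inj_on_def)
          ultimately show "?g e \<subseteq> ?W \<and> card (?g e) = ?r"
            unfolding e(1) coloured_image_def by (auto simp: card_image)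
        qed
        have "card ?E \<le> card (emb n N \<times> F)"
          using finF finite_emb[OF elim(3)] by (intro card_mono) auto
        then have "real (card ?E) \<le> m * p"
          unfolding m_def p_def by (simp add: card_cartesian_product flip: of_nat_mult)
        also have "\<dots> = K * real ?M" unfolding K_def using v k by (simp add: v_def)
        finally show "real (card ?E) \<le> K * real ?M" .
        show "\<forall>u w. u \<noteq> w \<longrightarrow> real (codegree ?E ?g u w) \<le> \<kappa> * K"
          unfolding \<kappa>K p_def using codegree_light_le[OF elim(3) finF] q by simp
      qed
      then obtain T where T: "T \<subseteq> templates k (V n)"
          "\<forall>c\<in>Forb V emb k N F n. \<exists>t\<in>T. c \<in> realisations k (V n) t"
        and few: "\<forall>t\<in>T. real (card {(\<phi>, c). \<phi> \<in> emb n N \<and> c \<in> F \<and>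
                        c \<in> realisations k (V N) (pullback (V N) \<phi> t)})
                    \<le> real (card ?Bad) * real (card F) + \<eta> * K * real ?M"
        and cT: "real (card T) \<le> 2 powr (\<eta> * real ?M)"
        using templates_of_containers[OF elim(3) assms(2), of \<eta> K ?M ?Bad] unfolding heavy_embs_def by blast
      have "\<eta> * K * real ?M = \<eta> * p * m" unfolding K_def using v k by (simp add: v_def)
      also have "\<dots> \<le> \<epsilon> / 2 * m" using \<eta>p m by (intro mult_right_mono) auto
      finally have "real (card ?Bad) * real (card F) + \<eta> * K * real ?M \<le> \<epsilon> * m"
        using bad unfolding p_def by (simp add: field_simps)
      then have few': "\<forall>t\<in>T. real (card {(\<phi>, c). \<phi> \<in> emb n N \<and> c \<in> F \<and>
                        c \<in> realisations k (V N) (pullback (V N) \<phi> t)}) \<le> \<epsilon> * real (card (emb n N))"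
        using few unfolding m_def by (meson order_trans)
      have "\<eta> * real ?M = \<eta> * real k * v" unfolding v_def by simp
      also have "\<dots> \<le> \<epsilon> * v" using \<eta>k v by (intro mult_right_mono) auto
      finally have "2 powr (\<eta> * real ?M) \<le> 2 powr (\<epsilon> * v)" by simp
      also have "\<dots> \<le> real k powr (\<epsilon> * v)" using k assms(4) v by (intro powr_mono2) auto
      finally have "real (card T) \<le> real k powr (\<epsilon> * real (card (V n)))" using cT unfolding v_def by linarith
      then show ?case using T few' by blast
    qed
  qed
  then obtain n0 where "\<And>n. n0 \<le> n \<Longrightarrow> ?good n"
    unfolding eventually_sequentially by blast
  then show ?thesis by (intro exI[of _ "Suc n0"]) simp
qed

end
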